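(* Let $\Lambda$ be any shifted TGL carpet (regardless of overlaps). Then $$\dim_{\rm P}\Lambda=\overline{\dim}_{\rm B}\Lambda\le s\le s_A,$$ where $s$ is the unique solution of $$\sum_{i=1}^Nb_i^{s_{\mathcal H}}a_i^{s-s_{\mathcal H}}=1 .$$ In particular, if $\Lambda$ satisfies the ROSC, then $\dim_{\rm P}\Lambda=\dim_{\rm B}\Lambda=s$.
   Context: Shifted TGL carpet: for $i\in[N]=\{1,\dots,N\}$ let $f_i(\underline x)=A_i\underline x+t_i$ on $\mathbb R^2$, with $A_i=\begin{pmatrix} b_i&0\\ d_i&a_i\end{pmatrix}$, $d_i\in\mathbb R$, $t_i=(t_{i,1},t_{i,2})^T$, $t_{i,1},t_{i,2}\ge0$, such that: (a) $0<a_i<b_i<1$ for all $i$; (b) $[N]$ is partitioned into $M>1$ nonempty consecutive blocks $\mathcal I_1,\dots,\mathcal I_M$ ("columns") with $|\mathcal I_m|=N_m$, and for $k,\ell\in\mathcal I_m$ we have $b_k=b_\ell=:r_m$ and $t_{k,1}=t_{\ell,1}=:u_m$; put $\mathcal H=\{h_m(x)=r_mx+u_m\}_{m=1}^M$; (c) $\sum_{j\in\mathcal I_m}a_j\le1$ for every $m$, and $\sum_{m=1}^Mr_m\le1$; (d) $f_i([0,1]^2)\subset[0,1]^2$ for all $i$, and the smallest and largest fixed points of the maps of $\mathcal H$ are $0$ and $1$. The attractor $\Lambda$ of $\mathcal F=\{f_i\}_{i=1}^N$ is called a shifted TGL carpet. $\dim_{\rm P}$, $\overline{\dim}_{\rm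 B}$, $\dim_{\rm B}$ are the packing, upper box and box dimension. $\Lambda_{\mathcal H}$ is the attractor of $\mathcal H$ and $s_{\mathcal H}=\dim_{\rm B}\Lambda_{\mathcal H}$. Let $\tilde s_x$ be the unique real with $\sum_{i=1}^Nb_i^{\tilde s_x}=1$. The affinity dimension of $\Lambda$ is $s_A$, the unique real such that $\sum_{i=1}^Nb_i^{\min\{\tilde s_x,1\}}a_i^{s_A-\min\{\tilde s_x,1\}}=1$. ROSC (rectangular open set condition): with $U=(0,1)^2$, $\Lambda\cap U\ne\emptyset$, $\bigcup_if_i(U)\subseteq U$ and $f_i(U)\cap f_j(U)=\emptyset$ for all $i\ne j$. *)

theory Defs
  imports "HOL-Analysis.Analysis"
begin

section \<open>Box and packing dimension\<close>

text \<open>The least number of sets of diameter at most \<open>\<delta>\<close> that cover \<open>E\<close>. It is only meaningful for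
  totally bounded \<open>E\<close>. Boundedness is required because \<^const>\<open>diameter\<close> is unspecified on
  unbounded sets.\<close>

definition covering_number :: "real \<Rightarrow> 'a::metric_space set \<Rightarrow> nat" where
  "covering_number \<delta> E =
     Inf {card C | C. finite C \<and> E \<subseteq> \<Union>C \<and> (\<forall>A\<in>C. bounded A \<and> diameter A \<le> \<delta>)}"

definition box_ratio :: "'a::metric_space set \<Rightarrow> real \<Rightarrow> real" where
  "box_ratio E \<delta> = ln (real (covering_number \<delta> E)) / (- ln \<delta>)"

definition upper_box_dim :: "'a::metric_space set \<Rightarrow> ereal" where
  "upper_box_dim E = Limsup (at_right 0) (\<lambda>\<delta>. ereal (box_ratio E \<delta>))"

text \<open>\<open>has_box_dim E s\<close> contains the existence of the limit; \<open>box_dim E\<close> is unspecified if the limit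
  does not exist.\<close>

definition has_box_dim :: "'a::metric_space set \<Rightarrow> real \<Rightarrow> bool" where
  "has_box_dim E s \<longleftrightarrow> (box_ratio E \<longlongrightarrow> s) (at_right 0)"

definition box_dim :: "'a::metric_space set \<Rightarrow> real" where
  "box_dim E = (THE s. has_box_dim E s)"

text \<open>A packing is given by its set of pairs (centre, radius); the diameter of a ball of radius \<open>r\<close>
  in a Euclidean space is \<open>2 * r\<close>.\<close>

definition is_packing :: "real \<Rightarrow> 'a::euclidean_space set \<Rightarrow> ('a \<times> real) set \<Rightarrow> bool" where
  "is_packing \<delta> E P \<longleftrightarrow> countable P \<and> (\<forall>(x, r)\<in>P. x \<in> E \<and> 0 < r \<and> r \<le> \<delta>) \<and>
     pairwise (\<lambda>(x, r) (y, q). disjnt (cball x r) (cball y q)) P"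

definition packing_content :: "real \<Rightarrow> real \<Rightarrow> 'a::euclidean_space set \<Rightarrow> ennreal" where
  "packing_content s \<delta> E =
     (SUP P\<in>{P. is_packing \<delta> E P}. \<Sum>\<^sub>\<infinity>(x, r)\<in>P. ennreal ((2 * r) powr s))"

text \<open>The content is nondecreasing in \<open>\<delta>\<close>, so its limit as \<open>\<delta>\<close> tends to 0 is the infimum.\<close>

definition packing_premeasure :: "real \<Rightarrow> 'a::euclidean_space set \<Rightarrow> ennreal" where
  "packing_premeasure s E = (INF \<delta>\<in>{0<..}. packing_content s \<delta> E)"

definition packing_measure :: "real \<Rightarrow> 'a::euclidean_space set \<Rightarrow> ennreal" where
  "packing_measure s E =
     (INF F\<in>{F :: nat \<Rightarrow> 'a set. E \<subseteq> (\<Union>i. F i)}. \<Sum>i. packing_premeasure s (F i))"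

definition packing_dim :: "'a::euclidean_space set \<Rightarrow> ereal" where
  "packing_dim E = Inf {ereal s | s. 0 \<le> s \<and> packing_measure s E = 0}"


section \<open>Shifted TGL carpets\<close>

definition is_attractor :: "'i set \<Rightarrow> ('i \<Rightarrow> 'a::metric_space \<Rightarrow> 'a) \<Rightarrow> 'a set \<Rightarrow> bool" where
  "is_attractor I f K \<longleftrightarrow> compact K \<and> K \<noteq> {} \<and> K = (\<Union>i\<in>I. f i ` K)"

definition tgl_map ::
  "(nat \<Rightarrow> real) \<Rightarrow> (nat \<Rightarrow> real) \<Rightarrow> (nat \<Rightarrow> real) \<Rightarrow> (nat \<Rightarrow> real^2) \<Rightarrow> nat \<Rightarrow> real^2 \<Rightarrow> real^2" where
  "tgl_map a b d t i x = vector [vector [b i, 0], vector [d i, a i]] *v x + t i"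

definition column_map :: "(nat \<Rightarrow> real) \<Rightarrow> (nat \<Rightarrow> real) \<Rightarrow> nat \<Rightarrow> real \<Rightarrow> real" where
  "column_map r u m x = r m * x + u m"

text \<open>The \<open>m\<close>-th of the consecutive blocks of lengths \<open>n 1, n 2, \<dots>\<close>, starting from index 1.\<close>

definition column :: "(nat \<Rightarrow> nat) \<Rightarrow> nat \<Rightarrow> nat set" where
  "column n m = {(\<Sum>l = 1..<m. n l)<..(\<Sum>l = 1..m. n l)}"

text \<open>Maps are indexed by \<open>{1..N}\<close> and columns by \<open>{1..M}\<close>; values of the parameters at other indices
  are irrelevant. The \<open>m\<close>-th column has \<open>n m\<close> maps.\<close>

locale shifted_TGL =
  fixes N M :: nat and n :: "nat \<Rightarrow> nat"
    and a b d :: "nat \<Rightarrow> real" and t :: "nat \<Rightarrow> real^2"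
    and r u :: "nat \<Rightarrow> real"
  assumes translations_nonneg: "i \<in> {1..N} \<Longrightarrow> 0 \<le> t i $ 1 \<and> 0 \<le> t i $ 2"
    and contractions: "i \<in> {1..N} \<Longrightarrow> 0 < a i \<and> a i < b i \<and> b i < 1"
    and columns: "1 < M" "m \<in> {1..M} \<Longrightarrow> 0 < n m" "N = (\<Sum>m = 1..M. n m)"
    and column_data: "m \<in> {1..M} \<Longrightarrow> k \<in> column n m \<Longrightarrow> b k = r m \<and> t k $ 1 = u m"
    and heights: "m \<in> {1..M} \<Longrightarrow> (\<Sum>j\<in>column n m. a j) \<le> 1"
    and widths: "(\<Sum>m = 1..M. r m) \<le> 1"
    and maps_square: "i \<in> {1..N} \<Longrightarrow> tgl_map a b d t i ` cbox 0 1 \<subseteq> cbox 0 1"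
    and least_fixed_point: "Min {x. \<exists>m\<in>{1..M}. column_map r u m x = x} = 0"
    and greatest_fixed_point: "Max {x. \<exists>m\<in>{1..M}. column_map r u m x = x} = 1"

definition rosc :: "'i set \<Rightarrow> ('i \<Rightarrow> real^2 \<Rightarrow> real^2) \<Rightarrow> (real^2) set \<Rightarrow> bool" where
  "rosc I f \<Lambda> \<longleftrightarrow> (let U = box 0 1 in
     \<Lambda> \<inter> U \<noteq> {} \<and> (\<Union>i\<in>I. f i ` U) \<subseteq> U \<and>
     (\<forall>i\<in>I. \<forall>j\<in>I. i \<noteq> j \<longrightarrow> f i ` U \<inter> f j ` U = {}))"

definition x_similarity_dim :: "nat \<Rightarrow> (nat \<Rightarrow> real) \<Rightarrow> real" where
  "x_similarity_dim N b = (THE s. (\<Sum>i = 1..N. b i powr s) = 1)"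

definition affinity_dim :: "nat \<Rightarrow> (nat \<Rightarrow> real) \<Rightarrow> (nat \<Rightarrow> real) \<Rightarrow> real" where
  "affinity_dim N a b =
     (let p = min (x_similarity_dim N b) 1
      in THE s. (\<Sum>i = 1..N. b i powr p * a i powr (s - p)) = 1)"

end

theory Submission
  imports Defs
begin

text \<open>
  For a word \<open>w\<close> the map \<open>f\<^sub>w\<close> sends the unit square to a parallelogram of width \<open>b\<^sub>w\<close>, vertical
  height \<open>a\<^sub>w \<le> b\<^sub>w\<close> and bounded slope. At scale \<open>\<delta>\<close> one looks at a set of words, the leaves of a
  finite tree of words, that all have height about \<open>\<delta>\<close>. Within such a thin parallelogram the carpet
  looks like its projection, the attractor \<open>\<Lambda>H\<close> of the column maps, so the piece \<open>f\<^sub>w(\<Lambda>)\<close> needs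
  about \<open>covering_number (a\<^sub>w / b\<^sub>w) \<Lambda>H\<close> sets of diameter \<open>\<delta>\<close>. This number is about
  \<open>(b\<^sub>w / a\<^sub>w) powr sH\<close>. The equation for \<open>s\<close> says that the weights
  \<open>b\<^sub>w powr sH * a\<^sub>w powr (s - sH)\<close> add up to 1 over the chosen words, so the sum of the numbers
  over the words is about \<open>\<delta> powr - s\<close>. Covering piece by piece bounds the upper box dimension by
  \<open>s\<close>, whatever the overlaps (lemmas \<open>covering_number_carpet_le\<close> and \<open>upper_box_dim_carpet_le\<close>).
  Under the rectangular open set condition the parallelograms are disjoint, and comparing areas
  shows that a set of diameter \<open>\<delta>\<close> meets boundedly many pieces. Then the sum is also a lower bound
  (\<open>card_pieces_meeting_le\<close>, \<open>sum_covering_number_base_le\<close>, \<open>lower_box_dim_carpet_ge\<close>).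

  Both estimates use that \<open>\<Lambda>H\<close> has a box dimension although the columns may overlap. The reason is
  that copies of \<open>\<Lambda>H\<close> can be placed at separated points of \<open>\<Lambda>H\<close>, which makes covering numbers
  supermultiplicative in the scale (\<open>covering_number_supermultiplicative\<close>); existence of the limit
  follows as in Fekete's lemma (\<open>upper_box_dim_le_lower_box_dim_of_supermultiplicative\<close>).

  The packing dimension equals the upper box dimension because small pieces of \<open>\<Lambda>\<close> are
  bi-Lipschitz copies of \<open>\<Lambda>\<close> and, by the Baire category theorem, one member of any countable
  cover is dense in such a piece (\<open>packing_dim_eq_upper_box_dim\<close>). Finally, the solution of
  \<open>\<Sum>i. b i powr p * a i powr (s - p) = 1\<close> increases with \<open>p\<close> since \<open>a i < b i\<close>, and the box
  dimension of \<open>\<Lambda>H\<close> is at most 1 and at most the similarity dimension, whence \<open>s\<close> is at most the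
  affinity dimension (\<open>weighted_equation_root_mono\<close>, \<open>root_le_affinity_dim\<close>).
\<close>

section \<open>Covering numbers\<close>

lemma diameter_le_dist:
  assumes "0 \<le> \<delta>" "\<And>x y. x \<in> A \<Longrightarrow> y \<in> A \<Longrightarrow> dist x y \<le> \<delta>"
  shows "diameter A \<le> \<delta>"
  unfolding diameter_def using assms by (auto intro!: cSUP_least)

lemma covering_number_le:
  assumes "finite C" "E \<subseteq> \<Union>C" "\<And>A. A \<in> C \<Longrightarrow> bounded A \<and> diameter A \<le> \<delta>"
  shows "covering_number \<delta> E \<le> card C"
  unfolding covering_number_def by (rule cInf_lower) (use assms in auto)

lemma covering_number_attained:
  fixes E :: "'a::heine_borel set"
  assumes "bounded E" "0 < \<delta>"
  obtains C where "finite C" "E \<subseteq> \<Union>C" "\<And>A. A \<in> C \<Longrightarrow> bounded A \<and> diameter A \<le> \<delta>"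
    "card C = covering_number \<delta> E"
proof -
  let ?S = "{card C | C. finite C \<and> E \<subseteq> \<Union>C \<and> (\<forall>A\<in>C. bounded A \<and> diameter A \<le> \<delta>)}"
  have "compact (closure E)"
    using assms by simp
  then obtain k where k: "finite k" "closure E \<subseteq> (\<Union>x\<in>k. ball x (\<delta> / 2))"
    using compact_eq_totally_bounded \<open>0 < \<delta>\<close> by (metis half_gt_zero)
  have "diameter (ball x (\<delta> / 2)) \<le> \<delta>" for x :: 'a
  proof (rule diameter_le_dist)
    show "dist y z \<le> \<delta>" if "y \<in> ball x (\<delta> / 2)" "z \<in> ball x (\<delta> / 2)" for y z
      using that dist_triangle2[of y z x] by (auto simp: dist_commute)
  qed (use \<open>0 < \<delta>\<close> in auto)
  then have "\<forall>A\<in>(\<lambda>x. ball x (\<delta> / 2)) ` k. bounded A \<and> diameter A \<le> \<delta>"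
    by auto
  moreover have "E \<subseteq> \<Union>((\<lambda>x. ball x (\<delta> / 2)) ` k)"
    using k(2) closure_subset[of E] by auto
  ultimately have "card ((\<lambda>x. ball x (\<delta> / 2)) ` k) \<in> ?S"
    using k(1) by blast
  then have "Inf ?S \<in> ?S"
    by (intro Inf_nat_def1) blast
  then show ?thesis
    using that unfolding covering_number_def by auto
qed

lemma covering_number_mono:
  fixes E :: "'a::heine_borel set"
  assumes "E \<subseteq> F" "bounded F" "0 < \<delta>" "\<delta> \<le> \<delta>'"
  shows "covering_number \<delta>' E \<le> covering_number \<delta> F"
proof -
  obtain C where "finite C" "F \<subseteq> \<Union>C" "\<And>A. A \<in> C \<Longrightarrow> bounded A \<and> diameter A \<le> \<delta>"
    "card C = covering_number \<delta> F"
    using covering_number_attained[OF assms(2,3)] by blast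
  moreover from this have "covering_number \<delta>' E \<le> card C"
    using assms(1,4) by (intro covering_number_le) fastforce+
  ultimately show ?thesis
    by simp
qed

lemma covering_number_pos:
  fixes E :: "'a::heine_borel set"
  assumes "E \<noteq> {}" "bounded E" "0 < \<delta>"
  shows "1 \<le> covering_number \<delta> E"
proof -
  obtain C where "finite C" "E \<subseteq> \<Union>C" "\<And>A. A \<in> C \<Longrightarrow> bounded A \<and> diameter A \<le> \<delta>"
    "card C = covering_number \<delta> E"
    using covering_number_attained[OF assms(2,3)] by blast
  moreover from this have "C \<noteq> {}"
    using assms(1) by auto
  ultimately show ?thesis
    by (metis One_nat_def Suc_leI card_gt_0_iff)
qed

lemma separated_card_le_covering_number:
  fixes E :: "'a::heine_borel set"
  assumes "Y \<subseteq> E" "bounded E" "0 < \<delta>" "pairwise (\<lambda>x y. \<delta> < dist x y) Y"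
  shows "finite Y" "card Y \<le> covering_number \<delta> E"
proof -
  obtain C where C: "finite C" "E \<subseteq> \<Union>C" "\<And>A. A \<in> C \<Longrightarrow> bounded A \<and> diameter A \<le> \<delta>"
    "card C = covering_number \<delta> E"
    using covering_number_attained[OF assms(2,3)] by blast
  have "\<forall>y\<in>Y. \<exists>A\<in>C. y \<in> A"
    using C(2) assms(1) by blast
  then obtain g where g: "\<And>y. y \<in> Y \<Longrightarrow> g y \<in> C \<and> y \<in> g y"
    by metis
  have "inj_on g Y"
  proof (rule inj_onI, rule ccontr)
    fix x y assume xy: "x \<in> Y" "y \<in> Y" "g x = g y" "x \<noteq> y"
    then have "dist x y \<le> diameter (g x)"
      using g C(3) by (metis diameter_bounded_bound)
    also have "\<dots> \<le> \<delta>"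
      using g C(3) xy by blast
    finally show False
      using assms(4) xy unfolding pairwise_def by fastforce
  qed
  moreover have "g ` Y \<subseteq> C"
    using g by blast
  ultimately show "finite Y" "card Y \<le> covering_number \<delta> E"
    using C(1,4) inj_on_finite card_inj_on_le by metis+
qed

text \<open>A separated set of maximal cardinality is a net: no further point can be added, so the balls
  about its points cover.\<close>

lemma separated_set_of_covering_number:
  fixes E :: "'a::heine_borel set"
  assumes "bounded E" "0 < \<delta>"
  obtains Y where "finite Y" "Y \<subseteq> E" "pairwise (\<lambda>x y. \<delta> < dist x y) Y"
    "covering_number (2 * \<delta>) E \<le> card Y"
proof -
  let ?P = "\<lambda>Y. Y \<subseteq> E \<and> pairwise (\<lambda>x y. \<delta> < dist x y) Y"
  have "\<forall>Y. ?P Y \<longrightarrow> card Y < Suc (covering_number \<delta> E)"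
    using separated_card_le_covering_number(2)[OF _ assms] by (auto simp: less_Suc_eq_le)
  then have "\<exists>Y. ?P Y \<and> (\<forall>Z. ?P Z \<longrightarrow> card Z \<le> card Y)"
    by (intro ex_has_greatest_nat[of ?P "{}"]) auto
  then obtain Y where Y: "?P Y" "\<And>Z. ?P Z \<Longrightarrow> card Z \<le> card Y"
    by blast
  have fin: "finite Y"
    using separated_card_le_covering_number(1) Y(1) assms by blast
  have "E \<subseteq> \<Union>((\<lambda>y. cball y \<delta>) ` Y)"
  proof (rule ccontr)
    assume "\<not> ?thesis"
    then obtain x where x: "x \<in> E" "\<And>y. y \<in> Y \<Longrightarrow> \<delta> < dist y x"
      by fastforce
    then have "?P (insert x Y)"
      using Y(1) by (auto simp: pairwise_insert dist_commute)
    moreover have "x \<notin> Y"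
      using x(2) \<open>0 < \<delta>\<close> by force
    ultimately show False
      using Y(2)[of "insert x Y"] fin by simp
  qed
  moreover have "diameter (cball y \<delta>) \<le> 2 * \<delta>" for y :: 'a
  proof (rule diameter_le_dist)
    show "dist x z \<le> 2 * \<delta>" if "x \<in> cball y \<delta>" "z \<in> cball y \<delta>" for x z
      using that dist_triangle2[of x z y] by (auto simp: dist_commute)
  qed (use \<open>0 < \<delta>\<close> in auto)
  ultimately have "covering_number (2 * \<delta>) E \<le> card ((\<lambda>y. cball y \<delta>) ` Y)"
    using fin by (intro covering_number_le) auto
  also have "\<dots> \<le> card Y"
    using fin by (rule card_image_le)
  finally show ?thesis
    using that fin Y(1) by blast
qed

section \<open>Box dimensions and the growth of covering numbers\<close>

lemma eventually_at_right_0_less: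
  fixes e :: real
  assumes "0 < e"
  shows "\<forall>\<^sub>F \<delta> in at_right 0. 0 < \<delta> \<and> \<delta> < e"
  using assms by (auto simp: eventually_at_right[OF assms])

lemma box_ratio_nonneg:
  fixes E :: "'a::heine_borel set"
  assumes "E \<noteq> {}" "bounded E" "0 < \<delta>" "\<delta> < 1"
  shows "0 \<le> box_ratio E \<delta>"
proof -
  have "1 \<le> real (covering_number \<delta> E)"
    using covering_number_pos[OF assms(1-3)] by simp
  then show ?thesis
    unfolding box_ratio_def using assms by (intro divide_nonneg_nonneg) auto
qed

lemma box_ratio_le_iff:
  fixes E :: "'a::heine_borel set"
  assumes "E \<noteq> {}" "bounded E" "0 < \<delta>" "\<delta> < 1"
  shows "box_ratio E \<delta> \<le> t \<longleftrightarrow> covering_number \<delta> E \<le> \<delta> powr - t"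
    and "box_ratio E \<delta> < t \<longleftrightarrow> covering_number \<delta> E < \<delta> powr - t"
proof -
  have N: "0 < real (covering_number \<delta> E)"
    using covering_number_pos[OF assms(1-3)] by simp
  have P: "0 < \<delta> powr - t"
    using assms by simp
  have ln: "ln \<delta> < 0"
    using assms by simp
  have "box_ratio E \<delta> \<le> t \<longleftrightarrow> ln (covering_number \<delta> E) \<le> ln (\<delta> powr - t)"
    unfolding box_ratio_def using ln assms by (subst pos_divide_le_eq) (auto simp: ln_powr)
  also have "\<dots> \<longleftrightarrow> covering_number \<delta> E \<le> \<delta> powr - t"
    by (rule ln_le_cancel_iff[OF N P])
  finally show "box_ratio E \<delta> \<le> t \<longleftrightarrow> covering_number \<delta> E \<le> \<delta> powr - t" .
  have "box_ratio E \<delta> < t \<longleftrightarrow> ln (covering_number \<delta> E) < ln (\<delta> powr - t)"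
    unfolding box_ratio_def using ln assms by (subst pos_divide_less_eq) (auto simp: ln_powr)
  also have "\<dots> \<longleftrightarrow> covering_number \<delta> E < \<delta> powr - t"
    by (rule ln_less_cancel_iff[OF N P])
  finally show "box_ratio E \<delta> < t \<longleftrightarrow> covering_number \<delta> E < \<delta> powr - t" .
qed

definition lower_box_dim :: "'a::metric_space set \<Rightarrow> ereal" where
  "lower_box_dim E = Liminf (at_right 0) (\<lambda>\<delta>. ereal (box_ratio E \<delta>))"

lemma lower_box_dim_le_upper_box_dim: "lower_box_dim E \<le> upper_box_dim E"
  unfolding lower_box_dim_def upper_box_dim_def by (rule Liminf_le_Limsup) simp

lemma lower_box_dim_nonneg:
  fixes E :: "'a::heine_borel set"
  assumes "E \<noteq> {}" "bounded E"
  shows "0 \<le> lower_box_dim E"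
  unfolding lower_box_dim_def
proof (rule Liminf_bounded)
  show "\<forall>\<^sub>F \<delta> in at_right 0. 0 \<le> ereal (box_ratio E \<delta>)"
    using eventually_at_right_0_less[OF zero_less_one] by eventually_elim (use box_ratio_nonneg[OF assms] in auto)
qed

lemma upper_box_dim_nonneg:
  fixes E :: "'a::heine_borel set"
  assumes "E \<noteq> {}" "bounded E"
  shows "0 \<le> upper_box_dim E"
  using lower_box_dim_nonneg[OF assms] lower_box_dim_le_upper_box_dim order_trans by blast

lemma has_box_dimI:
  assumes "upper_box_dim E \<le> ereal s" "ereal s \<le> lower_box_dim E"
  shows "has_box_dim E s"
proof -
  have "lower_box_dim E = ereal s" "upper_box_dim E = ereal s"
    using assms lower_box_dim_le_upper_box_dim[of E] by auto
  then have "((\<lambda>\<delta>. ereal (box_ratio E \<delta>)) \<longlongrightarrow> ereal s) (at_right 0)"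
    unfolding lower_box_dim_def upper_box_dim_def
    by (intro Liminf_eq_Limsup) auto
  then show ?thesis
    unfolding has_box_dim_def by simp
qed

lemma has_box_dimD:
  assumes "has_box_dim E s"
  shows "upper_box_dim E = ereal s" "lower_box_dim E = ereal s" "box_dim E = s"
proof -
  have "((\<lambda>\<delta>. ereal (box_ratio E \<delta>)) \<longlongrightarrow> ereal s) (at_right 0)"
    using assms unfolding has_box_dim_def by simp
  then show "upper_box_dim E = ereal s" "lower_box_dim E = ereal s"
    unfolding lower_box_dim_def upper_box_dim_def
    by (auto intro!: lim_imp_Limsup lim_imp_Liminf)
  show "box_dim E = s"
    unfolding box_dim_def using assms
    by (intro the_equality)
      (auto simp: has_box_dim_def intro: tendsto_unique[OF trivial_limit_at_right_real])
qed

text \<open>A multiplicative constant changes the ratio defining the dimension by \<open>ln C / - ln \<delta>\<close>, which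
  tends to 0.\<close>

lemma tendsto_log_correction:
  fixes C :: real
  shows "((\<lambda>\<delta>. ereal (t + ln C / - ln \<delta>)) \<longlongrightarrow> ereal t) (at_right 0)"
proof -
  have "((\<lambda>\<delta>. ln C / - ln \<delta>) \<longlongrightarrow> 0) (at_right (0::real))"
    by (rule tendsto_divide_0[OF tendsto_const])
      (auto intro!: filterlim_mono[OF _ at_top_le_at_infinity order_refl]
        simp: filterlim_uminus_at_bot[symmetric] ln_at_0)
  then have "((\<lambda>\<delta>. t + ln C / - ln \<delta>) \<longlongrightarrow> t + 0) (at_right (0::real))"
    by (intro tendsto_intros)
  then show ?thesis
    by simp
qed

lemma powr_log_correction:
  fixes C :: real
  assumes "0 < C" "0 < \<delta>" "\<delta> < 1"
  shows "\<delta> powr - (t + ln C / - ln \<delta>) = C * \<delta> powr - t"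
proof -
  have "\<delta> powr (ln C / ln \<delta>) = C"
    using assms by (simp add: powr_def)
  moreover have "- (t + ln C / - ln \<delta>) = - t + ln C / ln \<delta>"
    by simp
  ultimately show ?thesis
    by (simp only: powr_add mult.commute)
qed

lemma upper_box_dim_leI:
  fixes E :: "'a::heine_borel set"
  assumes "E \<noteq> {}" "bounded E" "0 < c" "0 < C"
    and bound: "\<And>\<delta>. 0 < \<delta> \<Longrightarrow> \<delta> \<le> 1 \<Longrightarrow> covering_number (c * \<delta>) E \<le> C * \<delta> powr - t"
  shows "upper_box_dim E \<le> ereal t"
proof -
  have c1: "0 < min c 1"
    using assms by simp
  define K where "K = C * c powr t"
  have K: "0 < K"
    using assms by (simp add: K_def)
  have "\<forall>\<^sub>F \<delta> in at_right 0. ereal (box_ratio E \<delta>) \<le> ereal (t + ln K / - ln \<delta>)"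
    using eventually_at_right_0_less[OF c1]
  proof eventually_elim
    case (elim \<delta>)
    then have \<delta>: "0 < \<delta>" "\<delta> < 1" "\<delta> / c \<le> 1"
      using \<open>0 < c\<close> by auto
    have "covering_number \<delta> E \<le> C * (\<delta> / c) powr - t"
      using bound[of "\<delta> / c"] \<delta> \<open>0 < c\<close> by simp
    also have "\<dots> = K * \<delta> powr - t"
      using \<delta> \<open>0 < c\<close> by (simp add: K_def powr_divide powr_minus field_simps)
    finally show ?case
      using box_ratio_le_iff(1)[OF assms(1,2) \<delta>(1,2)] powr_log_correction[OF K \<delta>(1,2)] by simp
  qed
  then have "upper_box_dim E \<le> Limsup (at_right 0) (\<lambda>\<delta>. ereal (t + ln K / - ln \<delta>))"
    unfolding upper_box_dim_def by (rule Limsup_mono)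
  also have "\<dots> = ereal t"
    by (rule lim_imp_Limsup[OF _ tendsto_log_correction]) simp
  finally show ?thesis .
qed

lemma lower_box_dim_geI:
  fixes E :: "'a::heine_borel set"
  assumes "E \<noteq> {}" "bounded E" "0 < c" "0 < C"
    and bound: "\<And>\<delta>. 0 < \<delta> \<Longrightarrow> \<delta> \<le> 1 \<Longrightarrow> C * \<delta> powr - t \<le> covering_number (c * \<delta>) E"
  shows "ereal t \<le> lower_box_dim E"
proof -
  have c1: "0 < min c 1"
    using assms by simp
  define K where "K = C * c powr t"
  have K: "0 < K"
    using assms by (simp add: K_def)
  have "\<forall>\<^sub>F \<delta> in at_right 0. ereal (t + ln K / - ln \<delta>) \<le> ereal (box_ratio E \<delta>)"
    using eventually_at_right_0_less[OF c1]
  proof eventually_elim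
    case (elim \<delta>)
    then have \<delta>: "0 < \<delta>" "\<delta> < 1" "\<delta> / c \<le> 1"
      using \<open>0 < c\<close> by auto
    have "K * \<delta> powr - t = C * (\<delta> / c) powr - t"
      using \<delta> \<open>0 < c\<close> by (simp add: K_def powr_divide powr_minus field_simps)
    also have "\<dots> \<le> covering_number \<delta> E"
      using bound[of "\<delta> / c"] \<delta> \<open>0 < c\<close> by simp
    finally show ?case
      using box_ratio_le_iff(2)[OF assms(1,2) \<delta>(1,2)] powr_log_correction[OF K \<delta>(1,2)]
      by (simp add: not_less[symmetric])
  qed
  then have "Liminf (at_right 0) (\<lambda>\<delta>. ereal (t + ln K / - ln \<delta>)) \<le> lower_box_dim E"
    unfolding lower_box_dim_def by (rule Liminf_mono)
  moreover have "Liminf (at_right 0) (\<lambda>\<delta>. ereal (t + ln K / - ln \<delta>)) = ereal t"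
    by (rule lim_imp_Liminf[OF _ tendsto_log_correction]) simp
  ultimately show ?thesis
    by simp
qed

lemma covering_number_upper_bound:
  fixes E :: "'a::heine_borel set"
  assumes "E \<noteq> {}" "bounded E" "upper_box_dim E < ereal t"
  obtains C where "0 < C" "\<And>\<delta>. 0 < \<delta> \<Longrightarrow> \<delta> \<le> 1 \<Longrightarrow> covering_number \<delta> E \<le> C * \<delta> powr - t"
proof -
  have t: "0 \<le> t"
    using upper_box_dim_nonneg[OF assms(1,2)] assms(3) by (metis ereal_less_eq(5) less_le order_trans)
  have "\<forall>\<^sub>F \<delta> in at_right 0. ereal (box_ratio E \<delta>) < ereal t"
    using assms(3) unfolding upper_box_dim_def by (rule Limsup_lessD)
  then obtain e where e: "0 < e" "\<And>\<delta>. 0 < \<delta> \<Longrightarrow> \<delta> < e \<Longrightarrow> box_ratio E \<delta> < t"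
    unfolding eventually_at_right[OF zero_less_one] by auto
  define \<delta>0 where "\<delta>0 = min e 1 / 2"
  have \<delta>0: "0 < \<delta>0" "\<delta>0 < e" "\<delta>0 < 1"
    using e(1) by (auto simp: \<delta>0_def)
  define C where "C = 1 + real (covering_number \<delta>0 E)"
  have "covering_number \<delta> E \<le> C * \<delta> powr - t" if \<delta>: "0 < \<delta>" "\<delta> \<le> 1" for \<delta>
  proof (cases "\<delta> < \<delta>0")
    case True
    then have "covering_number \<delta> E \<le> 1 * \<delta> powr - t"
      using e(2)[of \<delta>] box_ratio_le_iff(2)[OF assms(1,2)] \<delta> \<delta>0 by force
    also have "\<dots> \<le> C * \<delta> powr - t"
      by (intro mult_right_mono) (auto simp: C_def)
    finally show ?thesis .
  next
    case False
    then have "covering_number \<delta> E \<le> C * 1"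
      using covering_number_mono[OF order_refl assms(2) \<delta>0(1), of \<delta>] by (simp add: C_def)
    also have "1 \<le> \<delta> powr - t"
      using t \<delta> powr_mono'[of "- t" 0 \<delta>] by simp
    then have "C * 1 \<le> C * \<delta> powr - t"
      by (intro mult_left_mono) (auto simp: C_def)
    finally show ?thesis .
  qed
  then show ?thesis
    using that[of C] by (auto simp: C_def)
qed

lemma covering_number_lower_bound:
  fixes E :: "'a::heine_borel set"
  assumes "E \<noteq> {}" "bounded E" "ereal t < lower_box_dim E"
  obtains C where "0 < C" "\<And>\<delta>. 0 < \<delta> \<Longrightarrow> \<delta> \<le> 1 \<Longrightarrow> C * \<delta> powr - t \<le> covering_number \<delta> E"
proof -
  have "\<forall>\<^sub>F \<delta> in at_right 0. ereal t < ereal (box_ratio E \<delta>)"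
    using assms(3) unfolding lower_box_dim_def by (rule less_LiminfD)
  then obtain e where e: "0 < e" "\<And>\<delta>. 0 < \<delta> \<Longrightarrow> \<delta> < e \<Longrightarrow> t < box_ratio E \<delta>"
    unfolding eventually_at_right[OF zero_less_one] by auto
  define \<delta>0 where "\<delta>0 = min e 1 / 2"
  have \<delta>0: "0 < \<delta>0" "\<delta>0 < e" "\<delta>0 < 1"
    using e(1) by (auto simp: \<delta>0_def)
  define K where "K = 1 + \<delta>0 powr - t"
  have K: "1 \<le> K"
    by (simp add: K_def)
  have "1 / K * \<delta> powr - t \<le> covering_number \<delta> E" if \<delta>: "0 < \<delta>" "\<delta> \<le> 1" for \<delta>
  proof (cases "\<delta> < \<delta>0")
    case True
    have "1 / K * \<delta> powr - t \<le> 1 * \<delta> powr - t"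
      using K by (intro mult_right_mono) auto
    also have "\<dots> \<le> covering_number \<delta> E"
      using e(2)[of \<delta>] box_ratio_le_iff(1)[OF assms(1,2), of \<delta> t] True \<delta> \<delta>0 by force
    finally show ?thesis .
  next
    case False
    have "\<delta> powr - t \<le> K"
    proof (cases "t \<ge> 0")
      case True
      then have "\<delta> powr - t \<le> \<delta>0 powr - t"
        using False \<delta>0 by (intro powr_mono2') auto
      then show ?thesis
        by (simp add: K_def)
    next
      case False
      then have "\<delta> powr - t \<le> 1"
        using \<delta> by (intro powr_le1) auto
      then show ?thesis
        using K by simp
    qed
    then have "1 / K * \<delta> powr - t \<le> 1"
      using K by (simp add: field_simps)
    also have "\<dots> \<le> covering_number \<delta> E"
      using covering_number_pos[OF assms(1,2) \<delta>(1)] by simp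
    finally show ?thesis .
  qed
  then show ?thesis
    using that[of "1 / K"] K by auto
qed

section \<open>Words and stopping sets\<close>

text \<open>A word \<open>w\<close> acts by \<open>foldr f w\<close> and has weight \<open>prod_list (map p w)\<close>. The stopping sets are
  the sets of leaves of finite trees in which every inner node has one child for each letter.
  Whatever holds for one subdivision step (weights add up to 1, the pieces cover, the pieces are
  disjoint) therefore passes to stopping sets by rule induction.\<close>

inductive stopping_set :: "'i set \<Rightarrow> 'i list set \<Rightarrow> bool" for I where
  root: "stopping_set I {[]}"
| split: "(\<And>i. i \<in> I \<Longrightarrow> stopping_set I (W i)) \<Longrightarrow> stopping_set I (\<Union>i\<in>I. (#) i ` W i)"

lemma stopping_set_words:
  assumes "stopping_set I W"
  shows "W \<subseteq> lists I"
  using assms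
proof induction
  case (split W)
  then have "i # w \<in> lists I" if "i \<in> I" "w \<in> W i" for i w
    using that by (meson Cons_in_lists_iff subsetD)
  then show ?case
    by blast
qed simp

lemma stopping_set_finite:
  assumes "stopping_set I W" "finite I"
  shows "finite W"
  using assms by induction auto

lemma stopping_set_sum_weights:
  fixes p :: "'i \<Rightarrow> real"
  assumes "stopping_set I W" "finite I" "(\<Sum>i\<in>I. p i) = 1"
  shows "(\<Sum>w\<in>W. prod_list (map p w)) = 1"
  using assms(1)
proof induction
  case (split W)
  have "(\<Sum>w\<in>(\<Union>i\<in>I. (#) i ` W i). prod_list (map p w))
      = (\<Sum>i\<in>I. \<Sum>w\<in>(#) i ` W i. prod_list (map p w))"
    by (rule sum.UNION_disjoint)
      (use assms(2) split.hyps stopping_set_finite in auto)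
  also have "\<dots> = (\<Sum>i\<in>I. \<Sum>w\<in>W i. p i * prod_list (map p w))"
    by (simp add: sum.reindex)
  also have "\<dots> = (\<Sum>i\<in>I. p i)"
    using split.IH by (simp add: sum_distrib_left[symmetric])
  finally show ?case
    using assms(3) by simp
qed auto

lemma stopping_set_covers:
  assumes "stopping_set I W" "K \<subseteq> (\<Union>i\<in>I. f i ` K)"
  shows "K \<subseteq> (\<Union>w\<in>W. foldr f w ` K)"
  using assms(1)
proof induction
  case (split W)
  have "f i ` K \<subseteq> (\<Union>w\<in>(\<Union>i\<in>I. (#) i ` W i). foldr f w ` K)" if "i \<in> I" for i
    using split.IH[OF that] that by force
  then show ?case
    by (rule order_trans[OF assms(2) UN_least])
qed simp

lemma foldr_maps_into:
  assumes "\<And>i. i \<in> I \<Longrightarrow> f i ` K \<subseteq> K" "w \<in> lists I"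
  shows "foldr f w ` K \<subseteq> K"
  using assms(2)
proof (induction w)
  case (Cons i w)
  then show ?case
    using assms(1)[of i] by (auto simp: image_subset_iff)
qed auto

lemma stopping_set_disjoint:
  assumes "stopping_set I W"
    and into: "\<And>i. i \<in> I \<Longrightarrow> f i ` U \<subseteq> U" and inj: "\<And>i. i \<in> I \<Longrightarrow> inj_on (f i) U"
    and disj: "\<And>i j. i \<in> I \<Longrightarrow> j \<in> I \<Longrightarrow> i \<noteq> j \<Longrightarrow> f i ` U \<inter> f j ` U = {}"
  shows "disjoint_family_on (\<lambda>w. foldr f w ` U) W"
  using assms(1)
proof induction
  case (split W)
  have U: "foldr f w ` U \<subseteq> U" if "i \<in> I" "w \<in> W i" for i w
    using foldr_maps_into[of I f U w, OF into] stopping_set_words[OF split.hyps[OF that(1)]] that(2)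
    by (meson subsetD)
  show ?case
  proof (unfold disjoint_family_on_def, intro ballI impI)
    fix v v' assume "v \<in> (\<Union>i\<in>I. (#) i ` W i)" "v' \<in> (\<Union>i\<in>I. (#) i ` W i)" "v \<noteq> v'"
    then obtain i w i' w' where w: "i \<in> I" "w \<in> W i" "v = i # w" "i' \<in> I" "w' \<in> W i'" "v' = i' # w'"
      by blast
    have eq: "foldr f v ` U = f i ` (foldr f w ` U)" "foldr f v' ` U = f i' ` (foldr f w' ` U)"
      using w by (auto simp: image_image)
    show "foldr f v ` U \<inter> foldr f v' ` U = {}"
    proof (cases "i = i'")
      case True
      then have "foldr f w ` U \<inter> foldr f w' ` U = {}"
        using split.IH[of i] w \<open>v \<noteq> v'\<close> by (auto simp: disjoint_family_on_def)
      then show ?thesis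
        unfolding eq using inj_on_image_Int[OF inj[OF w(1)] U[OF w(1,2)] U[OF w(4,5)]] True by simp
    next
      case False
      then show ?thesis
        unfolding eq using disj[OF w(1,4)] U[OF w(1,2)] U[OF w(4,5)] by blast
    qed
  qed
qed (auto simp: disjoint_family_on_def)

text \<open>Splitting a word only while its ratio exceeds \<open>\<delta>\<close> produces ratios that are all comparable to
  \<open>\<delta>\<close>. After the first letter \<open>i\<close> the same task remains at scale \<open>\<delta> / \<rho> i\<close>, so the induction
  is on the number of powers of the largest ratio needed to reach the scale.\<close>

lemma stopping_set_exists:
  fixes \<rho> :: "'i \<Rightarrow> real"
  assumes "\<And>i. i \<in> I \<Longrightarrow> l \<le> \<rho> i" "\<And>i. i \<in> I \<Longrightarrow> \<rho> i \<le> R" "0 < l" "R < 1" "0 < \<delta>" "\<delta> \<le> 1"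
  obtains W where "stopping_set I W"
    "\<And>w. w \<in> W \<Longrightarrow> l * \<delta> \<le> prod_list (map \<rho> w) \<and> prod_list (map \<rho> w) \<le> \<delta>"
proof (cases "I = {}")
  case True
  then have "stopping_set I {}"
    using stopping_set.split[of I "\<lambda>_. {}"] by simp
  then show ?thesis
    using that by blast
next
  case False
  then have R: "0 < R" "l \<le> 1"
    using assms(1-4) by force+
  have pos: "0 < \<rho> i" if "i \<in> I" for i
    using assms(1)[OF that] assms(3) by linarith
  have "\<exists>W. stopping_set I W \<and> (\<forall>w\<in>W. l * \<delta> \<le> prod_list (map \<rho> w) \<and> prod_list (map \<rho> w) \<le> \<delta>)"
    if "R ^ k \<le> \<delta>" "0 < \<delta>" "\<delta> \<le> 1" for k \<delta>
    using that
  proof (induction k arbitrary: \<delta>)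
    case 0
    then have "\<delta> = 1"
      by simp
    then show ?case
      using stopping_set.root R(2) by (intro exI[of _ "{[]}"]) auto
  next
    case (Suc k)
    have "\<exists>W. stopping_set I W \<and>
        (\<forall>w\<in>W. l * \<delta> \<le> \<rho> i * prod_list (map \<rho> w) \<and> \<rho> i * prod_list (map \<rho> w) \<le> \<delta>)"
      if i: "i \<in> I" for i
    proof (cases "\<delta> \<le> \<rho> i")
      case True
      have "\<rho> i * R ^ k \<le> R * R ^ k"
        using assms(2)[OF i] R by (intro mult_right_mono) auto
      then have "R ^ k \<le> \<delta> / \<rho> i"
        using Suc.prems(1) pos[OF i] by (simp add: field_simps)
      then obtain W where "stopping_set I W"
        "\<forall>w\<in>W. l * (\<delta> / \<rho> i) \<le> prod_list (map \<rho> w) \<and> prod_list (map \<rho> w) \<le> \<delta> / \<rho> i"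
        using Suc.IH[of "\<delta> / \<rho> i"] True Suc.prems(2) pos[OF i] by auto
      then show ?thesis
        using pos[OF i] by (auto simp: field_simps)
    next
      case False
      have "l * \<delta> \<le> l * 1"
        using Suc.prems(3) assms(3) by (intro mult_left_mono) auto
      then have "l * \<delta> \<le> \<rho> i"
        using assms(1)[OF i] by simp
      then show ?thesis
        using False stopping_set.root by (intro exI[of _ "{[]}"]) auto
    qed
    then obtain W where "\<And>i. i \<in> I \<Longrightarrow> stopping_set I (W i)"
      "\<And>i w. i \<in> I \<Longrightarrow> w \<in> W i \<Longrightarrow>
        l * \<delta> \<le> \<rho> i * prod_list (map \<rho> w) \<and> \<rho> i * prod_list (map \<rho> w) \<le> \<delta>"
      by metis
    then show ?case
      by (intro exI[of _ "\<Union>i\<in>I. (#) i ` W i"]) (auto intro: stopping_set.split)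
  qed
  moreover obtain k where "R ^ k < \<delta>"
    using real_arch_pow_inv[OF assms(5,4)] by blast
  ultimately show ?thesis
    using that assms(5,6) by (meson less_imp_le)
qed

lemma prod_list_pos:
  fixes \<rho> :: "'i \<Rightarrow> real"
  assumes "\<And>i. i \<in> I \<Longrightarrow> 0 < \<rho> i" "w \<in> lists I"
  shows "0 < prod_list (map \<rho> w)"
  using assms(2) by induction (use assms(1) in auto)

lemma prod_list_powr:
  fixes \<rho> :: "'i \<Rightarrow> real"
  assumes "\<And>i. i \<in> I \<Longrightarrow> 0 < \<rho> i" "w \<in> lists I"
  shows "prod_list (map (\<lambda>i. \<rho> i powr s) w) = prod_list (map \<rho> w) powr s"
  using assms(2)
proof induction
  case (Cons i w)
  then show ?case
    using assms(1) prod_list_pos[of I \<rho> w] by (simp add: powr_mult less_imp_le)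
qed auto

lemma finite_ratio_bounds:
  fixes \<rho> :: "'i \<Rightarrow> real"
  assumes "finite I" "\<And>i. i \<in> I \<Longrightarrow> 0 < \<rho> i \<and> \<rho> i < 1"
  obtains l R where "0 < l" "l \<le> 1" "R < 1" "\<And>i. i \<in> I \<Longrightarrow> l \<le> \<rho> i" "\<And>i. i \<in> I \<Longrightarrow> \<rho> i \<le> R"
proof -
  define l where "l = Min (insert 1 (\<rho> ` I))"
  define R where "R = Max (insert 0 (\<rho> ` I))"
  have "0 < l" "l \<le> 1" "R < 1"
    using assms by (auto simp: l_def R_def)
  moreover have "l \<le> \<rho> i" "\<rho> i \<le> R" if "i \<in> I" for i
    using assms(1) that by (auto simp: l_def R_def)
  ultimately show ?thesis
    using that by blast
qed

lemma small_piece: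
  fixes f :: "'i \<Rightarrow> 'a::metric_space \<Rightarrow> 'a" and \<rho> :: "'i \<Rightarrow> real"
  assumes "finite I" "\<And>i. i \<in> I \<Longrightarrow> 0 < \<rho> i \<and> \<rho> i < 1" "K \<subseteq> (\<Union>i\<in>I. f i ` K)"
    and "x \<in> K" "0 < \<epsilon>"
  obtains w where "w \<in> lists I" "x \<in> foldr f w ` K" "prod_list (map \<rho> w) \<le> \<epsilon>"
proof -
  obtain l R where lR: "0 < l" "l \<le> 1" "R < 1"
    "\<And>i. i \<in> I \<Longrightarrow> l \<le> \<rho> i" "\<And>i. i \<in> I \<Longrightarrow> \<rho> i \<le> R"
    by (rule finite_ratio_bounds[of I \<rho>]) (use assms(1,2) in auto)
  obtain W where W: "stopping_set I W"
    "\<And>w. w \<in> W \<Longrightarrow> l * min \<epsilon> 1 \<le> prod_list (map \<rho> w) \<and> prod_list (map \<rho> w) \<le> min \<epsilon> 1"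
    by (rule stopping_set_exists[of I l \<rho> R "min \<epsilon> 1"]) (use lR \<open>0 < \<epsilon>\<close> in auto)
  obtain w where w: "w \<in> W" "x \<in> foldr f w ` K"
    using stopping_set_covers[OF W(1) assms(3)] \<open>x \<in> K\<close> by blast
  then show ?thesis
    using that[of w] W(2)[OF w(1)] stopping_set_words[OF W(1)] by auto
qed

text \<open>The images under long words of a point of \<open>C\<close> stay in \<open>C\<close> and come arbitrarily close to every
  point of \<open>K\<close>. Applied in both directions this gives the uniqueness of attractors. The constant
  \<open>L\<close> is there because a triangular matrix contracts only up to a factor that is uniform in the
  length of the word.\<close>

lemma attractor_subset_invariant:
  fixes f :: "'i \<Rightarrow> 'a::metric_space \<Rightarrow> 'a" and \<rho> :: "'i \<Rightarrow> real"
  assumes "finite I" "\<And>i. i \<in> I \<Longrightarrow> 0 < \<rho> i \<and> \<rho> i < 1" "K \<subseteq> (\<Union>i\<in>I. f i ` K)" "bounded K"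
    and inv: "closed C" "C \<noteq> {}" "\<And>i. i \<in> I \<Longrightarrow> f i ` C \<subseteq> C"
    and lip: "0 < L" "\<And>w x y. w \<in> lists I \<Longrightarrow>
      dist (foldr f w x) (foldr f w y) \<le> L * prod_list (map \<rho> w) * dist x y"
  shows "K \<subseteq> C"
proof
  fix x assume x: "x \<in> K"
  obtain c where c: "c \<in> C"
    using inv by blast
  obtain B where B: "\<And>y. y \<in> K \<Longrightarrow> dist c y \<le> B"
    using \<open>bounded K\<close> bounded_any_center by blast
  have B0: "0 \<le> B"
    using B[OF x] zero_le_dist order_trans by blast
  have "\<exists>y\<in>C. dist y x < \<epsilon>" if "0 < \<epsilon>" for \<epsilon>
  proof -
    define \<eta> where "\<eta> = \<epsilon> / (L * (B + 1))"
    have \<eta>: "0 < \<eta>"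
      using that lip(1) B0 by (auto simp: \<eta>_def)
    obtain w where w: "w \<in> lists I" "x \<in> foldr f w ` K" "prod_list (map \<rho> w) \<le> \<eta>"
      by (rule small_piece[of I \<rho> K f x \<eta>]) (use assms(1-3) x \<eta> in auto)
    then obtain y where y: "y \<in> K" "x = foldr f w y"
      by blast
    have "dist (foldr f w c) x \<le> L * prod_list (map \<rho> w) * dist c y"
      using lip(2)[OF w(1)] y by blast
    also have "\<dots> \<le> L * \<eta> * B"
      using w(3) B[OF y(1)] lip(1) \<eta> prod_list_pos[of I \<rho> w] assms(2) w(1)
      by (intro mult_mono) (auto simp: less_imp_le)
    also have "\<dots> < L * \<eta> * (B + 1)"
      using lip(1) \<eta> by simp
    also have "\<dots> = \<epsilon>"
      using lip(1) B0 by (simp add: \<eta>_def)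
    finally have "dist (foldr f w c) x < \<epsilon>" .
    moreover have "foldr f w ` C \<subseteq> C"
      by (rule foldr_maps_into[of I]) (use inv(3) w(1) in auto)
    then have "foldr f w c \<in> C"
      using c by blast
    ultimately show ?thesis
      by blast
  qed
  then show "x \<in> C"
    using closure_approachable[of x C] inv(1) by simp
qed

section \<open>Equations for the dimensions\<close>

lemma weighted_powr_sum_strict_antimono:
  fixes c \<rho> :: "'i \<Rightarrow> real"
  assumes "finite I" "I \<noteq> {}" "\<And>i. i \<in> I \<Longrightarrow> 0 < c i" "\<And>i. i \<in> I \<Longrightarrow> 0 < \<rho> i \<and> \<rho> i < 1" "s < s'"
  shows "(\<Sum>i\<in>I. c i * \<rho> i powr s') < (\<Sum>i\<in>I. c i * \<rho> i powr s)"
proof (rule sum_strict_mono)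
  fix i assume "i \<in> I"
  then show "c i * \<rho> i powr s' < c i * \<rho> i powr s"
    using assms(3-5) powr_less_mono'[of "\<rho> i" s s'] by simp
qed (use assms in auto)

lemma weighted_powr_sum_root:
  fixes c \<rho> :: "'i \<Rightarrow> real"
  assumes "finite I" "I \<noteq> {}" "\<And>i. i \<in> I \<Longrightarrow> 0 < c i" "\<And>i. i \<in> I \<Longrightarrow> 0 < \<rho> i \<and> \<rho> i < 1"
  shows "\<exists>!s. (\<Sum>i\<in>I. c i * \<rho> i powr s) = 1"
proof -
  define g where "g s = (\<Sum>i\<in>I. c i * \<rho> i powr s)" for s
  have anti: "g s' < g s" if "s < s'" for s s'
    unfolding g_def by (rule weighted_powr_sum_strict_antimono) (use assms that in auto)
  obtain i where i: "i \<in> I"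
    using assms(2) by blast
  \<comment> \<open>At this exponent the single term of index \<open>i\<close> equals 1.\<close>
  define x where "x = - ln (c i) / ln (\<rho> i)"
  have "c i * \<rho> i powr x = 1"
    using assms(3,4)[OF i] by (simp add: x_def powr_def exp_minus)
  moreover have "c i * \<rho> i powr x \<le> g x"
    unfolding g_def by (rule member_le_sum) (use i assms in \<open>auto simp: less_imp_le\<close>)
  ultimately have gx: "1 \<le> g x"
    by simp
  obtain l R where lR: "0 < l" "l \<le> 1" "R < 1"
    "\<And>i. i \<in> I \<Longrightarrow> l \<le> \<rho> i" "\<And>i. i \<in> I \<Longrightarrow> \<rho> i \<le> R"
    by (rule finite_ratio_bounds[of I \<rho>]) (use assms in auto)
  define S where "S = (\<Sum>i\<in>I. c i)"
  have S: "0 < S"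
    unfolding S_def by (rule sum_pos) (use assms in auto)
  obtain k where k: "R ^ k < 1 / S"
    using real_arch_pow_inv[of "1 / S" R] lR(3) S by auto
  have "g (real k) \<le> (\<Sum>i\<in>I. c i * R ^ k)"
    unfolding g_def
  proof (rule sum_mono)
    fix i assume i: "i \<in> I"
    then have "\<rho> i powr real k = \<rho> i ^ k"
      using assms(4) by (intro powr_realpow) auto
    moreover have "\<rho> i ^ k \<le> R ^ k"
      using lR(5)[OF i] assms(4)[OF i] by (intro power_mono) auto
    ultimately show "c i * \<rho> i powr real k \<le> c i * R ^ k"
      using assms(3)[OF i] by simp
  qed
  also have "\<dots> = S * R ^ k"
    by (simp add: S_def sum_distrib_right)
  also have "\<dots> < 1"
    using k S by (simp add: field_simps)
  finally have gk: "g (real k) < 1" .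
  have "x \<le> real k"
    using anti[of "real k" x] gx gk by (cases "x \<le> real k") auto
  moreover have "continuous_on {x..real k} g"
    unfolding g_def by (intro continuous_intros) (use assms(4) in force)
  ultimately obtain s where "g s = 1"
    using IVT2'[of g "real k" 1 x] gx gk by auto
  moreover have "s' = s" if "g s' = 1" "g s = 1" for s s'
    using anti[of s s'] anti[of s' s] that by (cases s s' rule: linorder_cases) auto
  ultimately show ?thesis
    unfolding g_def[symmetric] by blast
qed

section \<open>Self-similar sets\<close>

locale self_similar_set =
  fixes I :: "'i set" and f :: "'i \<Rightarrow> 'a::heine_borel \<Rightarrow> 'a" and \<rho> :: "'i \<Rightarrow> real" and K :: "'a set"
  assumes finite_index: "finite I"
    and ratios: "i \<in> I \<Longrightarrow> 0 < \<rho> i \<and> \<rho> i < 1"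
    and similarity: "i \<in> I \<Longrightarrow> dist (f i x) (f i y) = \<rho> i * dist x y"
    and compact: "compact K" and nonempty: "K \<noteq> {}"
    and self_similar: "K = (\<Union>i\<in>I. f i ` K)"
begin

lemma dist_foldr:
  assumes "w \<in> lists I"
  shows "dist (foldr f w x) (foldr f w y) = prod_list (map \<rho> w) * dist x y"
  using assms by induction (auto simp: similarity)

lemma foldr_image_subset:
  assumes "w \<in> lists I"
  shows "foldr f w ` K \<subseteq> K"
proof (rule foldr_maps_into[OF _ assms])
  show "f i ` K \<subseteq> K" if "i \<in> I" for i
    using that by (subst (2) self_similar) blast
qed

lemma bounded: "bounded K"
  using compact by (rule compact_imp_bounded)

lemma dist_bound:
  obtains D where "1 \<le> D" "\<And>x y. x \<in> K \<Longrightarrow> y \<in> K \<Longrightarrow> dist x y \<le> D"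
proof -
  have "dist x y \<le> max 1 (diameter K)" if "x \<in> K" "y \<in> K" for x y
    using diameter_bounded_bound[OF bounded that] by simp
  then show ?thesis
    using that[of "max 1 (diameter K)"] by auto
qed

text \<open>The pieces of a stopping set at scale \<open>\<delta>\<close> cover, and there are at most about \<open>\<delta> powr - s\<close>
  of them because their weights \<open>\<rho>\<^sub>w powr s\<close> add up to 1.\<close>

lemma upper_box_dim_le_similarity_dim:
  assumes "(\<Sum>i\<in>I. \<rho> i powr s) = 1" "0 \<le> s"
  shows "upper_box_dim K \<le> ereal s"
proof -
  obtain D where D: "1 \<le> D" "\<And>x y. x \<in> K \<Longrightarrow> y \<in> K \<Longrightarrow> dist x y \<le> D"
    using dist_bound by blast
  obtain l R where lR: "0 < l" "l \<le> 1" "R < 1"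
    "\<And>i. i \<in> I \<Longrightarrow> l \<le> \<rho> i" "\<And>i. i \<in> I \<Longrightarrow> \<rho> i \<le> R"
    by (rule finite_ratio_bounds[of I \<rho>]) (use finite_index ratios in auto)
  have "covering_number (D * \<delta>) K \<le> l powr - s * \<delta> powr - s" if \<delta>: "0 < \<delta>" "\<delta> \<le> 1" for \<delta>
  proof -
    obtain W where W: "stopping_set I W"
      "\<And>w. w \<in> W \<Longrightarrow> l * \<delta> \<le> prod_list (map \<rho> w) \<and> prod_list (map \<rho> w) \<le> \<delta>"
      by (rule stopping_set_exists[of I l \<rho> R \<delta>]) (use lR \<delta> in auto)
    have words: "w \<in> lists I" if "w \<in> W" for w
      using stopping_set_words[OF W(1)] that by blast
    have fin: "finite W"
      using stopping_set_finite[OF W(1) finite_index] .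
    let ?C = "(\<lambda>w. foldr f w ` K) ` W"
    have "diameter (foldr f w ` K) \<le> D * \<delta>" if w: "w \<in> W" for w
    proof (rule diameter_le_dist)
      fix x y assume "x \<in> foldr f w ` K" "y \<in> foldr f w ` K"
      then obtain x' y' where xy: "x' \<in> K" "y' \<in> K" "x = foldr f w x'" "y = foldr f w y'"
        by blast
      have "dist x y = prod_list (map \<rho> w) * dist x' y'"
        using dist_foldr[OF words[OF w]] xy by simp
      also have "\<dots> \<le> \<delta> * D"
        using W(2)[OF w] D(2)[OF xy(1,2)] \<delta> by (intro mult_mono) auto
      finally show "dist x y \<le> D * \<delta>"
        by (simp add: mult.commute)
    qed (use D \<delta> in auto)
    moreover have "Elementary_Metric_Spaces.bounded (foldr f w ` K)" if "w \<in> W" for w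
      by (rule bounded_subset[OF bounded foldr_image_subset[OF words[OF that]]])
    moreover have "K \<subseteq> \<Union>?C"
      using stopping_set_covers[OF W(1), of K f] self_similar by simp
    ultimately have "covering_number (D * \<delta>) K \<le> card ?C"
      using fin by (intro covering_number_le) auto
    also have "\<dots> \<le> card W"
      using fin by (rule card_image_le)
    finally have "real (covering_number (D * \<delta>) K) \<le> real (card W)"
      by simp
    also have "real (card W) \<le> (l * \<delta>) powr - s"
    proof -
      have "(\<Sum>w\<in>W. (l * \<delta>) powr s) \<le> (\<Sum>w\<in>W. prod_list (map (\<lambda>i. \<rho> i powr s) w))"
      proof (rule sum_mono)
        fix w assume w: "w \<in> W"
        have "(l * \<delta>) powr s \<le> prod_list (map \<rho> w) powr s"
          using W(2)[OF w] assms(2) lR(1) \<delta> by (intro powr_mono2) auto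
        also have "\<dots> = prod_list (map (\<lambda>i. \<rho> i powr s) w)"
          by (rule prod_list_powr[symmetric]) (use ratios words[OF w] in auto)
        finally show "(l * \<delta>) powr s \<le> prod_list (map (\<lambda>i. \<rho> i powr s) w)" .
      qed
      also have "\<dots> = 1"
        by (rule stopping_set_sum_weights[OF W(1) finite_index assms(1)])
      finally show ?thesis
        using lR(1) \<delta> by (simp add: powr_minus field_simps)
    qed
    also have "\<dots> = l powr - s * \<delta> powr - s"
      using lR(1) \<delta> by (simp add: powr_mult)
    finally show ?thesis .
  qed
  then show ?thesis
    using D(1) lR(1) by (intro upper_box_dim_leI[OF nonempty bounded, of D "l powr - s"]) auto
qed

text \<open>Replacing each point of a \<open>\<delta>\<close>-separated set by a copy of diameter about \<open>\<delta>\<close> of a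
  \<open>\<delta>'\<close>-separated set gives a set that is separated at scale about \<open>\<delta> * \<delta>'\<close>, whatever the
  overlaps. The factor 8 keeps different copies apart.\<close>

lemma covering_number_supermultiplicative:
  obtains c where "0 < c" "c \<le> 1"
    "\<And>\<delta> \<delta>'. 0 < \<delta> \<Longrightarrow> \<delta> \<le> 1 \<Longrightarrow> 0 < \<delta>' \<Longrightarrow> \<delta>' \<le> 1 \<Longrightarrow>
       covering_number \<delta> K * covering_number \<delta>' K \<le> covering_number (c * \<delta> * \<delta>') K"
proof -
  obtain D where D: "1 \<le> D" "\<And>x y. x \<in> K \<Longrightarrow> y \<in> K \<Longrightarrow> dist x y \<le> D"
    using dist_bound by blast
  obtain l R where lR: "0 < l" "l \<le> 1" "R < 1"
    "\<And>i. i \<in> I \<Longrightarrow> l \<le> \<rho> i" "\<And>i. i \<in> I \<Longrightarrow> \<rho> i \<le> R"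
    by (rule finite_ratio_bounds[of I \<rho>]) (use finite_index ratios in auto)
  define c where "c = l / (16 * D)"
  have c: "0 < c" "c \<le> 1 / 16"
    using lR(1,2) D(1) by (auto simp: c_def field_simps)
  have "covering_number \<delta> K * covering_number \<delta>' K \<le> covering_number (c * \<delta> * \<delta>') K"
    if \<delta>: "0 < \<delta>" "\<delta> \<le> 1" "0 < \<delta>'" "\<delta>' \<le> 1" for \<delta> \<delta>'
  proof -
    obtain Y where Y: "finite Y" "Y \<subseteq> K" "pairwise (\<lambda>x y. \<delta> / 2 < dist x y) Y"
      "covering_number (2 * (\<delta> / 2)) K \<le> card Y"
      by (rule separated_set_of_covering_number[OF bounded, of "\<delta> / 2"]) (use \<delta> in auto)
    obtain Z where Z: "finite Z" "Z \<subseteq> K" "pairwise (\<lambda>x y. \<delta>' / 2 < dist x y) Z"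
      "covering_number (2 * (\<delta>' / 2)) K \<le> card Z"
      by (rule separated_set_of_covering_number[OF bounded, of "\<delta>' / 2"]) (use \<delta> in auto)
    obtain W where W: "stopping_set I W"
      "\<And>w. w \<in> W \<Longrightarrow> l * (\<delta> / (8 * D)) \<le> prod_list (map \<rho> w) \<and> prod_list (map \<rho> w) \<le> \<delta> / (8 * D)"
      by (rule stopping_set_exists[of I l \<rho> R "\<delta> / (8 * D)"]) (use lR \<delta> D(1) in auto)
    have words: "w \<in> lists I" if "w \<in> W" for w
      using stopping_set_words[OF W(1)] that by blast
    have "K \<subseteq> (\<Union>w\<in>W. foldr f w ` K)"
      using stopping_set_covers[OF W(1), of K f] self_similar by simp
    then have "\<forall>y\<in>Y. \<exists>w\<in>W. y \<in> foldr f w ` K"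
      using Y(2) by blast
    then obtain v where v: "\<And>y. y \<in> Y \<Longrightarrow> v y \<in> W \<and> y \<in> foldr f (v y) ` K"
      by metis
    define g where "g p = foldr f (v (fst p)) (snd p)" for p
    have gK: "g p \<in> K" if "p \<in> Y \<times> Z" for p
    proof -
      have "v (fst p) \<in> W" "snd p \<in> K"
        using v Z(2) that by auto
      then show ?thesis
        using foldr_image_subset[OF words] by (auto simp: g_def)
    qed
    have near: "dist (g p) (fst p) \<le> \<delta> / 8" if p: "p \<in> Y \<times> Z" for p
    proof -
      obtain y where y: "y \<in> K" "fst p = foldr f (v (fst p)) y"
        using v p by force
      have "dist (g p) (fst p) = prod_list (map \<rho> (v (fst p))) * dist (snd p) y"
        using dist_foldr[of "v (fst p)" "snd p" y] words v p y(2) by (auto simp: g_def)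
      also have "\<dots> \<le> \<delta> / (8 * D) * D"
        using W(2)[of "v (fst p)"] v p D y(1) Z(2) \<delta> by (intro mult_mono) auto
      finally show ?thesis
        using D(1) by simp
    qed
    have sep: "c * \<delta> * \<delta>' < dist (g p) (g q)" if pq: "p \<in> Y \<times> Z" "q \<in> Y \<times> Z" "p \<noteq> q" for p q
    proof (cases "fst p = fst q")
      case True
      then have "snd p \<noteq> snd q"
        using pq(3) by (simp add: prod_eq_iff)
      then have z: "\<delta>' / 2 < dist (snd p) (snd q)"
        using Z(3) pq by (auto simp: pairwise_def)
      have "c * \<delta> * \<delta>' = l * (\<delta> / (8 * D)) * (\<delta>' / 2)"
        by (simp add: c_def)
      also have "\<dots> < l * (\<delta> / (8 * D)) * dist (snd p) (snd q)"
        using z lR(1) \<delta> D(1) by (intro mult_strict_left_mono) auto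
      also have "\<dots> \<le> prod_list (map \<rho> (v (fst p))) * dist (snd p) (snd q)"
        using W(2)[of "v (fst p)"] v pq by (intro mult_right_mono) auto
      also have "\<dots> = dist (g p) (g q)"
        using dist_foldr[of "v (fst p)"] words v pq True by (auto simp: g_def)
      finally show ?thesis .
    next
      case False
      then have "\<delta> / 2 < dist (fst p) (fst q)"
        using Y(3) pq by (auto simp: pairwise_def)
      also have "\<dots> \<le> dist (fst p) (g p) + dist (g p) (g q) + dist (g q) (fst q)"
        using dist_triangle[of "fst p" "fst q" "g p"] dist_triangle[of "g p" "fst q" "g q"] by linarith
      finally have "\<delta> / 4 < dist (g p) (g q)"
        using near[OF pq(1)] near[OF pq(2)] by (simp add: dist_commute)
      moreover have "c * \<delta> * \<delta>' \<le> 1 / 16 * \<delta> * 1"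
        using c \<delta> by (intro mult_mono) auto
      ultimately show ?thesis
        using \<delta> by linarith
    qed
    have pos: "0 < c * \<delta> * \<delta>'"
      using c \<delta> by simp
    have "inj_on g (Y \<times> Z)"
    proof (rule inj_onI, rule ccontr)
      fix p q assume "p \<in> Y \<times> Z" "q \<in> Y \<times> Z" "g p = g q" "p \<noteq> q"
      then show False
        using sep[of p q] pos by simp
    qed
    then have "card Y * card Z = card (g ` (Y \<times> Z))"
      by (simp add: card_image card_cartesian_product)
    also have "\<dots> \<le> covering_number (c * \<delta> * \<delta>') K"
    proof (rule separated_card_le_covering_number(2)[OF _ bounded pos])
      show "pairwise (\<lambda>x y. c * \<delta> * \<delta>' < dist x y) (g ` (Y \<times> Z))"
        unfolding pairwise_def using sep by blast
    qed (use gK in blast)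
    finally have "card Y * card Z \<le> covering_number (c * \<delta> * \<delta>') K" .
    moreover have "covering_number \<delta> K * covering_number \<delta>' K \<le> card Y * card Z"
      using Y(4) Z(4) by (intro mult_le_mono) auto
    ultimately show ?thesis
      by linarith
  qed
  then show ?thesis
    using that[of c] c by auto
qed

end

text \<open>A single scale at which the covering number is large propagates along a geometric sequence of
  scales and hence, by monotonicity, to all scales (the argument of Fekete's lemma).\<close>

lemma upper_box_dim_le_lower_box_dim_of_supermultiplicative:
  fixes E :: "'a::heine_borel set"
  assumes "E \<noteq> {}" "bounded E" "0 < c" "c \<le> 1"
    and mult: "\<And>\<delta> \<delta>'. 0 < \<delta> \<Longrightarrow> \<delta> \<le> 1 \<Longrightarrow> 0 < \<delta>' \<Longrightarrow> \<delta>' \<le> 1 \<Longrightarrow>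
       covering_number \<delta> E * covering_number \<delta>' E \<le> covering_number (c * \<delta> * \<delta>') E"
  shows "upper_box_dim E \<le> lower_box_dim E"
proof (rule ccontr)
  assume "\<not> ?thesis"
  then have "lower_box_dim E < upper_box_dim E"
    by (simp add: not_le)
  then obtain t where t: "lower_box_dim E < ereal t" "ereal t < upper_box_dim E"
    using ereal_dense2 by blast
  from ereal_dense2[OF t(2)] obtain t' where t': "t < t'" "ereal t' < upper_box_dim E"
    by auto
  have t0: "0 < t"
    using lower_box_dim_nonneg[OF assms(1,2)] t(1) by (metis ereal_less(2) le_less_trans)
  \<comment> \<open>Below the scale \<open>e\<close> the gap between \<open>t\<close> and \<open>t'\<close> absorbs the constant \<open>c\<close>.\<close>
  define e where "e = min 1 (c powr (t / (t' - t)))"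
  have e: "0 < e"
    using assms(3) by (auto simp: e_def)
  have "\<not> (\<forall>\<^sub>F \<delta> in at_right 0. ereal (box_ratio E \<delta>) \<le> ereal t')"
  proof
    assume "\<forall>\<^sub>F \<delta> in at_right 0. ereal (box_ratio E \<delta>) \<le> ereal t'"
    then have "upper_box_dim E \<le> ereal t'"
      unfolding upper_box_dim_def by (rule Limsup_bounded)
    then show False
      using t'(2) by simp
  qed
  then obtain \<delta>0 where \<delta>0: "0 < \<delta>0" "\<delta>0 < e" "t' < box_ratio E \<delta>0"
    using eventually_mono[OF eventually_at_right_0_less[OF e], of "\<lambda>\<delta>. ereal (box_ratio E \<delta>) \<le> ereal t'"]
    by (meson not_le ereal_less_eq(3))
  then have "\<delta>0 < 1"
    by (simp add: e_def)
  define q where "q = c * \<delta>0"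
  have "q \<le> \<delta>0"
    using assms(3,4) \<delta>0(1) by (simp add: q_def)
  then have "q < 1"
    using \<open>\<delta>0 < 1\<close> by linarith
  have "0 < q"
    using assms(3) \<delta>0(1) by (simp add: q_def)
  note q = this \<open>q < 1\<close>
  have "\<delta>0 powr (t' - t) \<le> (c powr (t / (t' - t))) powr (t' - t)"
    using \<delta>0 t'(1) by (intro powr_mono2) (auto simp: e_def)
  also have "\<dots> = c powr t"
    using t'(1) by (simp add: powr_powr)
  finally have "q powr - t \<le> \<delta>0 powr - t'"
    using \<delta>0(1) assms(3) by (simp add: q_def powr_mult powr_minus powr_diff field_simps)
  also have "\<dots> < covering_number \<delta>0 E"
    using box_ratio_le_iff(1)[OF assms(1,2) \<delta>0(1) \<open>\<delta>0 < 1\<close>, of t'] \<delta>0(3) by linarith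
  finally have N0: "q powr - t \<le> covering_number \<delta>0 E"
    by simp
  have N: "(q powr - t) ^ k \<le> covering_number (q ^ k) E" for k
  proof (induction k)
    case 0
    show ?case
      using covering_number_pos[OF assms(1,2), of 1] by simp
  next
    case (Suc k)
    have "(q powr - t) ^ Suc k \<le> real (covering_number \<delta>0 E) * real (covering_number (q ^ k) E)"
      unfolding power_Suc by (intro mult_mono N0 Suc.IH) auto
    also have "\<dots> \<le> covering_number (c * \<delta>0 * q ^ k) E"
      using mult[of \<delta>0 "q ^ k"] \<delta>0(1) \<open>\<delta>0 < 1\<close> q
      by (simp add: power_le_one flip: of_nat_mult)
    finally show ?case
      by (simp add: q_def)
  qed
  have "q powr t * \<delta> powr - t \<le> covering_number (1 * \<delta>) E" if \<delta>: "0 < \<delta>" "\<delta> \<le> 1" for \<delta>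
  proof -
    define k where "k = (LEAST k. q ^ k < \<delta>)"
    obtain k' where "q ^ k' < \<delta>"
      using real_arch_pow_inv[OF \<delta>(1) q(2)] by blast
    then have k: "q ^ k < \<delta>"
      unfolding k_def by (rule LeastI)
    then have "k \<noteq> 0"
      using \<delta>(2) by (intro notI) simp
    then obtain j where j: "k = Suc j"
      using not0_implies_Suc by blast
    then have "\<not> q ^ j < \<delta>"
      unfolding k_def by (metis lessI not_less_Least)
    then have qj: "\<delta> \<le> q ^ j" "q ^ j < \<delta> / q"
      using k q j by (auto simp: field_simps)
    have "q powr t * \<delta> powr - t = (\<delta> / q) powr - t"
      using q(1) \<delta>(1) by (simp add: powr_divide powr_minus field_simps)
    also have "\<dots> \<le> (q ^ j) powr - t"
      using qj q t0 by (intro powr_mono2') auto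
    also have "\<dots> = (q powr - t) ^ j"
      using q by (simp add: powr_power powr_realpow[symmetric] powr_powr mult.commute)
    also have "\<dots> \<le> covering_number (q ^ j) E"
      by (rule N)
    also have "\<dots> \<le> covering_number \<delta> E"
      using covering_number_mono[OF order_refl assms(2) \<delta>(1) qj(1)] by simp
    finally show ?thesis
      by simp
  qed
  then have "ereal t \<le> lower_box_dim E"
    by (intro lower_box_dim_geI[OF assms(1,2), of 1 "q powr t"]) (use q in auto)
  then show False
    using t(1) by simp
qed

lemma (in self_similar_set) box_dim_exists:
  obtains s where "has_box_dim K s" "0 \<le> s"
proof -
  have "I \<noteq> {}"
    using nonempty self_similar by auto
  then obtain s where s: "(\<Sum>i\<in>I. 1 * \<rho> i powr s) = 1"
    using weighted_powr_sum_root[of I "\<lambda>_. 1" \<rho>] finite_index ratios by auto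
  have "0 \<le> s"
  proof (rule ccontr)
    assume "\<not> 0 \<le> s"
    then have "(\<Sum>i\<in>I. 1 * \<rho> i powr 0) < (\<Sum>i\<in>I. 1 * \<rho> i powr s)"
      by (intro weighted_powr_sum_strict_antimono) (use finite_index ratios \<open>I \<noteq> {}\<close> in auto)
    moreover have "(\<Sum>i\<in>I. 1 * \<rho> i powr 0) = real (card I)"
    proof -
      have "(\<Sum>i\<in>I. 1 * \<rho> i powr 0) = (\<Sum>i\<in>I. 1)"
        by (rule sum.cong) (use ratios in force)+
      then show ?thesis
        by simp
    qed
    moreover have "1 \<le> card I"
      using \<open>I \<noteq> {}\<close> finite_index by (simp add: Suc_le_eq card_gt_0_iff)
    ultimately show False
      using s by simp
  qed
  then have up: "upper_box_dim K \<le> ereal s"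
    using upper_box_dim_le_similarity_dim s by simp
  obtain c where c: "0 < c" "c \<le> 1"
    "\<And>\<delta> \<delta>'. 0 < \<delta> \<Longrightarrow> \<delta> \<le> 1 \<Longrightarrow> 0 < \<delta>' \<Longrightarrow> \<delta>' \<le> 1 \<Longrightarrow>
       covering_number \<delta> K * covering_number \<delta>' K \<le> covering_number (c * \<delta> * \<delta>') K"
    using covering_number_supermultiplicative by blast
  then have le: "upper_box_dim K \<le> lower_box_dim K"
    by (intro upper_box_dim_le_lower_box_dim_of_supermultiplicative[OF nonempty bounded, of c])
  have "0 \<le> upper_box_dim K"
    by (rule upper_box_dim_nonneg[OF nonempty bounded])
  with up obtain d where "upper_box_dim K = ereal d" "0 \<le> d"
    by (cases "upper_box_dim K") auto
  then show ?thesis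
    using that[of d] le has_box_dimI[of K d] by simp
qed

lemma upper_box_dim_mono:
  fixes E :: "'a::heine_borel set"
  assumes "E \<noteq> {}" "E \<subseteq> F" "bounded F"
  shows "upper_box_dim E \<le> upper_box_dim F"
  unfolding upper_box_dim_def
proof (rule Limsup_mono)
  have bE: "bounded E"
    using assms bounded_subset by blast
  show "\<forall>\<^sub>F \<delta> in at_right 0. ereal (box_ratio E \<delta>) \<le> ereal (box_ratio F \<delta>)"
    using eventually_at_right_0_less[OF zero_less_one]
  proof eventually_elim
    case (elim \<delta>)
    then have "1 \<le> covering_number \<delta> E" "covering_number \<delta> E \<le> covering_number \<delta> F"
      using covering_number_pos[OF assms(1) bE] covering_number_mono[OF assms(2,3)] by auto
    then have "ln (covering_number \<delta> E) \<le> ln (covering_number \<delta> F)"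
      by simp
    then show ?case
      unfolding box_ratio_def using elim by (simp add: divide_right_mono divide_right_mono_neg)
  qed
qed

text \<open>The unit interval is self-similar with two maps of ratio 1/2, so the bound by the similarity
  dimension applies.\<close>

lemma upper_box_dim_unit_interval_le_1: "upper_box_dim {0..1::real} \<le> 1"
proof -
  interpret self_similar_set "{0, 1 :: nat}" "\<lambda>i x. x / 2 + real i / 2" "\<lambda>_. 1 / 2" "{0..1::real}"
  proof
    have "x \<in> (\<lambda>x. x / 2) ` {0..1} \<union> (\<lambda>x. x / 2 + 1 / 2) ` {0..1}" if "x \<in> {0..1}" for x :: real
    proof (cases "x \<le> 1 / 2")
      case True
      then show ?thesis
        using that by (intro UnI1 image_eqI[of _ _ "2 * x"]) auto
    next
      case False
      then show ?thesis
        using that by (intro UnI2 image_eqI[of _ _ "2 * x - 1"]) (auto simp: field_simps)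
    qed
    then have "{0..1} \<subseteq> (\<lambda>x. x / 2) ` {0..1::real} \<union> (\<lambda>x. x / 2 + 1 / 2) ` {0..1}"
      by blast
    moreover have "(\<lambda>x. x / 2) ` {0..1::real} \<union> (\<lambda>x. x / 2 + 1 / 2) ` {0..1} \<subseteq> {0..1}"
      by auto
    moreover have "(\<Union>i\<in>{0, 1 :: nat}. (\<lambda>x. x / 2 + real i / 2) ` {0..1::real})
        = (\<lambda>x. x / 2) ` {0..1} \<union> (\<lambda>x. x / 2 + 1 / 2) ` {0..1}"
      by simp
    ultimately show "{0..1} = (\<Union>i\<in>{0, 1 :: nat}. (\<lambda>x. x / 2 + real i / 2) ` {0..1::real})"
      by (metis subset_antisym)
  qed (auto simp: dist_real_def simp flip: diff_divide_distrib)
  show ?thesis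
    using upper_box_dim_le_similarity_dim[of 1] by (simp add: one_ereal_def)
qed

section \<open>Packing dimension\<close>

lemma sum_geometric_tail_le:
  fixes q :: real
  assumes "0 \<le> q" "q < 1" "finite S" "S \<subseteq> {n..}"
  shows "(\<Sum>k\<in>S. q ^ k) \<le> q ^ n / (1 - q)"
proof -
  define m where "m = Max (insert 0 S) + 1"
  have "S \<subseteq> {n..<n + m}"
  proof
    fix k assume "k \<in> S"
    moreover from this have "k \<le> Max (insert 0 S)"
      using assms(3) by simp
    ultimately show "k \<in> {n..<n + m}"
      using assms(4) \<open>k \<in> S\<close> by (auto simp: m_def)
  qed
  then have "(\<Sum>k\<in>S. q ^ k) \<le> (\<Sum>k = n..<n + m. q ^ k)"
    using assms by (intro sum_mono2) auto
  also have "\<dots> = (q ^ n - q ^ (n + m)) / (1 - q)"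
  proof -
    have "(1 - q) * (\<Sum>k = n..<n + m. q ^ k) = q ^ n - q ^ (n + m)" for m
    proof (induction m)
      case (Suc m)
      have "(1 - q) * (\<Sum>k = n..<n + Suc m. q ^ k)
          = (1 - q) * (\<Sum>k = n..<n + m. q ^ k) + (1 - q) * q ^ (n + m)"
        by (simp add: distrib_left)
      then show ?case
        using Suc by (simp add: left_diff_distrib)
    qed simp
    then show ?thesis
      using assms(2) by (simp add: eq_divide_eq mult.commute)
  qed
  also have "\<dots> \<le> q ^ n / (1 - q)"
    using assms by (intro divide_right_mono) auto
  finally show ?thesis .
qed

text \<open>The balls of a packing are grouped by dyadic size. The centres in one group are separated at
  the scale of the group, so the covering number bounds their number, and the bounds for the groups
  form a geometric series.\<close>

lemma packing_sum_le:
  fixes E :: "'a::euclidean_space set"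
  assumes "bounded E" "0 < C" "t < s" "0 \<le> s"
    and count: "\<And>\<delta>. 0 < \<delta> \<Longrightarrow> \<delta> \<le> 1 \<Longrightarrow> covering_number \<delta> E \<le> C * \<delta> powr - t"
    and F: "finite F" "is_packing ((1 / 2) ^ n) E F"
  shows "(\<Sum>(x, r)\<in>F. (2 * r) powr s)
    \<le> C * 2 powr (t + s) * ((2 powr (t - s)) ^ n / (1 - 2 powr (t - s)))"
proof -
  define q :: real where "q = 2 powr (t - s)"
  have q: "0 < q" "q < 1"
    using assms(3) powr_less_mono[of "t - s" 0 2] by (auto simp: q_def)
  have rad: "x \<in> E" "0 < r" "r \<le> (1 / 2) ^ n" if "(x, r) \<in> F" for x r
    using F(2) that by (auto simp: is_packing_def)
  have "\<exists>k. (1 / 2) ^ Suc k < r \<and> r \<le> (1 / 2) ^ k" if r: "0 < r" "r \<le> 1" for r :: real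
  proof -
    define k where "k = (LEAST k. (1 / 2) ^ k < r)"
    obtain k' where "(1 / 2) ^ k' < r"
      using real_arch_pow_inv[OF r(1), of "1 / 2"] by auto
    then have k: "(1 / 2) ^ k < r"
      unfolding k_def by (rule LeastI)
    then have "k \<noteq> 0"
      using r(2) by (intro notI) simp
    then obtain j where j: "k = Suc j"
      using not0_implies_Suc by blast
    then have "\<not> (1 / 2) ^ j < r"
      unfolding k_def by (metis lessI not_less_Least)
    then show ?thesis
      using k j by (intro exI[of _ j]) auto
  qed
  then obtain \<kappa> where \<kappa>: "\<And>r::real. 0 < r \<Longrightarrow> r \<le> 1 \<Longrightarrow> (1 / 2) ^ Suc (\<kappa> r) < r \<and> r \<le> (1 / 2) ^ \<kappa> r"
    by metis
  have r1: "r \<le> 1" if "(x, r) \<in> F" for x r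
    using rad(3)[OF that] power_le_one[of "1 / 2 :: real" n] by simp
  have \<kappa>n: "n \<le> \<kappa> r" if "(x, r) \<in> F" for x r
  proof -
    have "(1 / 2) ^ Suc (\<kappa> r) < (1 / 2 :: real) ^ n"
      using \<kappa>[OF rad(2)[OF that] r1[OF that]] rad(3)[OF that] by linarith
    then have "n < Suc (\<kappa> r)"
      by (subst (asm) power_strict_decreasing_iff) auto
    then show ?thesis
      by simp
  qed
  have group: "(\<Sum>(x, r)\<in>{p \<in> F. \<kappa> (snd p) = k}. (2 * r) powr s) \<le> C * 2 powr (t + s) * q ^ k" for k
  proof -
    let ?G = "{p \<in> F. \<kappa> (snd p) = k}"
    let ?\<eta> = "(1 / 2 :: real) ^ Suc k"
    have sep: "?\<eta> < dist (fst p) (fst p')" if p: "p \<in> ?G" "p' \<in> ?G" "p \<noteq> p'" for p p'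
    proof -
      obtain x r y r' where xy: "p = (x, r)" "p' = (y, r')"
        by (metis surj_pair)
      have "disjnt (cball x r) (cball y r')"
        using F(2) p xy unfolding is_packing_def pairwise_def by auto
      moreover have "0 < r'" "0 < r" "r \<le> 1" "?\<eta> < r"
        using rad[of x r] rad[of y r'] r1[of x r] \<kappa>[of r] p xy by auto
      moreover from this have "y \<in> cball y r'"
        by simp
      ultimately have "y \<notin> cball x r"
        unfolding disjnt_iff by blast
      then have "r < dist x y"
        by (simp add: not_le)
      then show ?thesis
        using \<open>?\<eta> < r\<close> xy by simp
    qed
    have "inj_on fst ?G"
    proof (rule inj_onI, rule ccontr)
      fix p p' assume "p \<in> ?G" "p' \<in> ?G" "fst p = fst p'" "p \<noteq> p'"
      then show False
        using sep[of p p'] by simp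
    qed
    then have "card ?G = card (fst ` ?G)"
      by (simp add: card_image)
    also have "\<dots> \<le> covering_number ?\<eta> E"
    proof (rule separated_card_le_covering_number(2)[OF _ assms(1)])
      show "fst ` ?G \<subseteq> E"
        using rad(1) by auto
      show "pairwise (\<lambda>x y. ?\<eta> < dist x y) (fst ` ?G)"
        unfolding pairwise_def using sep by blast
    qed simp
    finally have "real (card ?G) \<le> real (covering_number ?\<eta> E)"
      by simp
    also have "\<dots> \<le> C * ?\<eta> powr - t"
      by (intro count power_le_one) auto
    finally have card: "real (card ?G) \<le> C * ?\<eta> powr - t" .
    have "(\<Sum>(x, r)\<in>?G. (2 * r) powr s) \<le> (\<Sum>p\<in>?G. (2 * (1 / 2) ^ k) powr s)"
    proof (rule sum_mono)
      fix p assume "p \<in> ?G"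
      then show "(case p of (x, r) \<Rightarrow> (2 * r) powr s) \<le> (2 * (1 / 2) ^ k) powr s"
        using rad(2) r1 \<kappa> assms(4) by (cases p) (auto intro!: powr_mono2 simp: less_imp_le)
    qed
    also have "\<dots> \<le> C * ?\<eta> powr - t * (2 * (1 / 2) ^ k) powr s"
      using card by (simp add: mult_right_mono)
    also have "?\<eta> powr - t = 2 powr t * 2 powr (t * real k)"
    proof -
      have "?\<eta> = 2 powr - real (Suc k)"
        by (simp only: powr_minus powr_realpow zero_less_numeral power_one_over inverse_eq_divide)
      then show ?thesis
        by (simp add: powr_powr flip: powr_add) (simp add: algebra_simps)
    qed
    also have "(2 * (1 / 2) ^ k) powr s = 2 powr s * 2 powr (- s * real k)"
    proof -
      have "(1 / 2) ^ k = (2::real) powr - real k"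
        by (simp only: powr_minus powr_realpow zero_less_numeral power_one_over inverse_eq_divide)
      then show ?thesis
        by (simp add: powr_mult powr_powr mult.commute)
    qed
    also have "C * (2 powr t * 2 powr (t * real k)) * (2 powr s * 2 powr (- s * real k))
        = C * 2 powr (t + s) * q ^ k"
    proof -
      have "q ^ k = 2 powr ((t - s) * real k)"
        by (simp add: q_def powr_powr flip: powr_realpow)
      then show ?thesis
        by (simp add: powr_add[symmetric] algebra_simps)
    qed
    finally show ?thesis .
  qed
  have "(\<Sum>(x, r)\<in>F. (2 * r) powr s)
      = (\<Sum>k\<in>(\<lambda>p. \<kappa> (snd p)) ` F. \<Sum>(x, r)\<in>{p \<in> F. \<kappa> (snd p) = k}. (2 * r) powr s)"
    by (rule sum.image_gen[OF F(1)])
  also have "\<dots> \<le> (\<Sum>k\<in>(\<lambda>p. \<kappa> (snd p)) ` F. C * 2 powr (t + s) * q ^ k)"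
    by (rule sum_mono[OF group])
  also have "\<dots> = C * 2 powr (t + s) * (\<Sum>k\<in>(\<lambda>p. \<kappa> (snd p)) ` F. q ^ k)"
    by (simp add: sum_distrib_left)
  also have "\<dots> \<le> C * 2 powr (t + s) * (q ^ n / (1 - q))"
    using q F(1) \<kappa>n assms(2) by (intro mult_left_mono sum_geometric_tail_le) auto
  finally show ?thesis
    by (simp add: q_def)
qed

lemma packing_premeasure_eq_0:
  fixes E :: "'a::euclidean_space set"
  assumes "bounded E" "0 < C" "t < s" "0 \<le> s"
    and count: "\<And>\<delta>. 0 < \<delta> \<Longrightarrow> \<delta> \<le> 1 \<Longrightarrow> covering_number \<delta> E \<le> C * \<delta> powr - t"
  shows "packing_premeasure s E = 0"
proof -
  define q :: real where "q = 2 powr (t - s)"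
  define B where "B n = C * 2 powr (t + s) * (q ^ n / (1 - q))" for n
  have q: "0 < q" "q < 1"
    using assms(3) powr_less_mono[of "t - s" 0 2] by (auto simp: q_def)
  have "packing_premeasure s E \<le> ennreal (B n)" for n
  proof -
    have "packing_content s ((1 / 2) ^ n) E \<le> ennreal (B n)"
      unfolding packing_content_def
    proof (rule SUP_least)
      fix P :: "('a \<times> real) set" assume P: "P \<in> {P. is_packing ((1 / 2) ^ n) E P}"
      have "(\<Sum>(x, r)\<in>F. ennreal ((2 * r) powr s)) \<le> ennreal (B n)" if F: "finite F" "F \<subseteq> P" for F
      proof -
        have "is_packing ((1 / 2) ^ n) E F"
          using P F by (auto simp: is_packing_def intro: countable_finite pairwise_subset)
        then have "(\<Sum>(x, r)\<in>F. (2 * r) powr s) \<le> B n"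
          using packing_sum_le[OF assms F(1)] by (simp add: B_def q_def)
        moreover have "(\<Sum>(x, r)\<in>F. ennreal ((2 * r) powr s)) = ennreal (\<Sum>(x, r)\<in>F. (2 * r) powr s)"
          by (simp add: case_prod_unfold)
        ultimately show ?thesis
          by (simp add: ennreal_leI)
      qed
      then show "(\<Sum>\<^sub>\<infinity>(x, r)\<in>P. ennreal ((2 * r) powr s)) \<le> ennreal (B n)"
        by (subst nonneg_infsum_complete) (auto intro!: SUP_least)
    qed
    then show ?thesis
      unfolding packing_premeasure_def by (intro INF_lower2) auto
  qed
  moreover have "(\<lambda>n. ennreal (B n)) \<longlonglongrightarrow> ennreal 0"
  proof (rule tendsto_ennrealI)
    have "B \<longlonglongrightarrow> C * 2 powr (t + s) * (0 / (1 - q))"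
      unfolding B_def using q by (intro tendsto_intros LIMSEQ_power_zero) auto
    then show "B \<longlonglongrightarrow> 0"
      by simp
  qed
  ultimately have "packing_premeasure s E \<le> ennreal 0"
    by (intro LIMSEQ_le_const) auto
  then show ?thesis
    by simp
qed

lemma packing_dim_le_upper_box_dim:
  fixes E :: "'a::euclidean_space set"
  assumes "E \<noteq> {}" "bounded E"
  shows "packing_dim E \<le> upper_box_dim E"
proof (rule dense_ge)
  fix y assume "upper_box_dim E < y"
  then obtain s where s: "upper_box_dim E < ereal s" "ereal s < y"
    using ereal_dense2 by blast
  from ereal_dense2[OF s(1)] obtain t where t: "upper_box_dim E < ereal t" "t < s"
    by auto
  have "0 < ereal s"
    by (rule le_less_trans[OF upper_box_dim_nonneg[OF assms] s(1)])
  then have s0: "0 \<le> s"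
    by simp
  obtain C where "0 < C" "\<And>\<delta>. 0 < \<delta> \<Longrightarrow> \<delta> \<le> 1 \<Longrightarrow> covering_number \<delta> E \<le> C * \<delta> powr - t"
    using covering_number_upper_bound[OF assms t(1)] by blast
  then have "packing_premeasure s E = 0"
    using packing_premeasure_eq_0[OF assms(2) _ t(2) s0] by blast
  moreover have "packing_measure s E \<le> (\<Sum>i::nat. packing_premeasure s E)"
    unfolding packing_measure_def by (rule INF_lower[of "\<lambda>_. E"]) auto
  ultimately have "packing_measure s E = 0"
    by simp
  then have "packing_dim E \<le> ereal s"
    unfolding packing_dim_def using s0 by (intro Inf_lower) auto
  then show "packing_dim E \<le> y"
    using s(2) by simp
qed

lemma separated_card_le_of_packing_content:
  fixes F :: "'a::euclidean_space set"
  assumes "packing_content s \<delta>0 F \<le> 1" "finite Y" "Y \<subseteq> F" "pairwise (\<lambda>x y. 2 * \<delta> < dist x y) Y"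
    and "0 < \<delta>" "\<delta> \<le> \<delta>0"
  shows "card Y \<le> (2 * \<delta>) powr - s"
proof -
  let ?P = "(\<lambda>y. (y, \<delta>)) ` Y"
  have "disjnt (cball x \<delta>) (cball y \<delta>)" if "2 * \<delta> < dist x y" for x y :: 'a
    unfolding disjnt_iff
  proof (intro allI notI)
    fix z assume "z \<in> cball x \<delta> \<and> z \<in> cball y \<delta>"
    then show False
      using that dist_triangle2[of x y z] by (simp add: dist_commute)
  qed
  then have "is_packing \<delta>0 F ?P"
    using assms by (auto simp: is_packing_def pairwise_def intro!: countable_finite)
  then have "(\<Sum>\<^sub>\<infinity>(x, r)\<in>?P. ennreal ((2 * r) powr s)) \<le> packing_content s \<delta>0 F"
    unfolding packing_content_def by (intro SUP_upper) simp
  also note assms(1)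
  finally have "(\<Sum>\<^sub>\<infinity>(x, r)\<in>?P. ennreal ((2 * r) powr s)) \<le> 1" .
  moreover have "(\<Sum>\<^sub>\<infinity>(x, r)\<in>?P. ennreal ((2 * r) powr s)) = ennreal (card Y * (2 * \<delta>) powr s)"
    using assms(2) by (simp add: sum.reindex inj_on_def ennreal_mult ennreal_of_nat_eq_real_of_nat)
  ultimately have "card Y * (2 * \<delta>) powr s \<le> 1"
    by simp
  then show ?thesis
    using assms(5) by (simp add: powr_minus field_simps)
qed

text \<open>Otherwise the sets \<open>K - closure (F i)\<close> would all be open and dense in \<open>K\<close>, but their
  intersection is empty because the sets \<open>F i\<close> cover \<open>K\<close>.\<close>

lemma compact_countable_cover_dense_piece:
  fixes K :: "'a::euclidean_space set" and F :: "nat \<Rightarrow> 'a set"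
  assumes "compact K" "K \<noteq> {}" "K \<subseteq> (\<Union>i. F i)"
  obtains i x \<epsilon> where "x \<in> K" "0 < \<epsilon>" "K \<inter> ball x \<epsilon> \<subseteq> closure (F i)"
proof -
  have "\<exists>i. \<not> K \<subseteq> closure (K - closure (F i))"
  proof (rule ccontr)
    assume "\<not> ?thesis"
    then have dense: "K \<subseteq> closure (K - closure (F i))" for i
      by blast
    let ?G = "range (\<lambda>i. K - closure (F i))"
    have "K \<subseteq> closure (\<Inter>?G)"
    proof (rule Baire)
      show "closed K"
        using assms(1) by (rule compact_imp_closed)
      show "openin (top_of_set K) T \<and> K \<subseteq> closure T" if "T \<in> ?G" for T
        using that dense by (auto simp: Diff_eq openin_open_Int)
    qed simp
    moreover have "\<Inter>?G = {}"
    proof -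
      have "x \<notin> \<Inter>?G" for x
      proof (cases "x \<in> K")
        case True
        then obtain i where "x \<in> F i"
          using assms(3) by blast
        then have "x \<notin> K - closure (F i)"
          using closure_subset by blast
        then show ?thesis
          by blast
      qed blast
      then show ?thesis
        by blast
    qed
    ultimately show False
      using assms(2) by (metis closure_empty subset_empty)
  qed
  then obtain i x where x: "x \<in> K" "x \<notin> closure (K - closure (F i))"
    by blast
  then obtain \<epsilon> where \<epsilon>: "0 < \<epsilon>" "\<And>y. y \<in> K - closure (F i) \<Longrightarrow> \<epsilon> \<le> dist y x"
    unfolding closure_approachable by (auto simp: not_less)
  then have "K \<inter> ball x \<epsilon> \<subseteq> closure (F i)"
    by (fastforce simp: dist_commute)
  then show ?thesis
    using that[OF x(1) \<epsilon>(1)] by blast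
qed

text \<open>If the packing measure of \<open>K\<close> vanishes at \<open>s\<close>, then \<open>K\<close> has a countable cover by sets of finite
  premeasure, and one of them is dense in an open piece of \<open>K\<close>, hence in a copy of \<open>K\<close>. A separated
  subset of \<open>K\<close> can therefore be moved into that set by a small perturbation. The balls about the
  resulting points form a packing, so there are at most about \<open>\<delta> powr - s\<close> points.\<close>

lemma packing_dim_eq_upper_box_dim:
  fixes K :: "'a::euclidean_space set"
  assumes "compact K" "K \<noteq> {}"
    and copies: "\<And>x \<epsilon>. x \<in> K \<Longrightarrow> 0 < \<epsilon> \<Longrightarrow> \<exists>g c. 0 < c \<and> g ` K \<subseteq> K \<inter> ball x \<epsilon> \<and>
      (\<forall>y\<in>K. \<forall>z\<in>K. c * dist y z \<le> dist (g y) (g z))"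
  shows "packing_dim K = upper_box_dim K"
proof (rule antisym)
  have bK: "bounded K"
    using assms(1) by (rule compact_imp_bounded)
  show "packing_dim K \<le> upper_box_dim K"
    using packing_dim_le_upper_box_dim[OF assms(2) bK] .
  show "upper_box_dim K \<le> packing_dim K"
    unfolding packing_dim_def
  proof (rule Inf_greatest)
    fix y assume "y \<in> {ereal s | s. 0 \<le> s \<and> packing_measure s K = 0}"
    then obtain s where s: "y = ereal s" "0 \<le> s" "packing_measure s K = 0"
      by blast
    then have "packing_measure s K < 1"
      by simp
    then obtain F :: "nat \<Rightarrow> 'a set" where F: "K \<subseteq> (\<Union>i. F i)" "(\<Sum>i. packing_premeasure s (F i)) < 1"
      unfolding packing_measure_def INF_less_iff by blast
    obtain i x \<epsilon> where i: "x \<in> K" "0 < \<epsilon>" "K \<inter> ball x \<epsilon> \<subseteq> closure (F i)"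
      by (rule compact_countable_cover_dense_piece[OF assms(1,2) F(1)])
    obtain g c where g: "0 < c" "g ` K \<subseteq> K \<inter> ball x \<epsilon>"
      "\<And>y z. y \<in> K \<Longrightarrow> z \<in> K \<Longrightarrow> c * dist y z \<le> dist (g y) (g z)"
      using copies[OF i(1,2)] by blast
    have "packing_premeasure s (F i) < 1"
      using F(2) by (rule ennreal_suminf_lessD)
    then obtain \<delta>0 where \<delta>0: "0 < \<delta>0" "packing_content s \<delta>0 (F i) \<le> 1"
      unfolding packing_premeasure_def INF_less_iff by (auto intro: less_imp_le)
    have "covering_number (8 * \<delta>0 / c * \<delta>) K \<le> (2 * \<delta>0) powr - s * \<delta> powr - s"
      if \<delta>: "0 < \<delta>" "\<delta> \<le> 1" for \<delta>
    proof -
      define \<eta> where "\<eta> = \<delta>0 * \<delta>"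
      have \<eta>: "0 < \<eta>" "\<eta> \<le> \<delta>0"
        using \<delta> \<delta>0(1) by (auto simp: \<eta>_def mult_left_le)
      obtain Y where Y: "finite Y" "Y \<subseteq> K" "pairwise (\<lambda>x y. 4 * \<eta> / c < dist x y) Y"
        "covering_number (2 * (4 * \<eta> / c)) K \<le> card Y"
        by (rule separated_set_of_covering_number[OF bK, of "4 * \<eta> / c"]) (use \<eta>(1) g(1) in auto)
      have "\<forall>y\<in>Y. \<exists>p\<in>F i. dist p (g y) < \<eta>"
      proof
        fix y assume "y \<in> Y"
        then have "g y \<in> closure (F i)"
          using Y(2) g(2) i(3) by blast
        then show "\<exists>p\<in>F i. dist p (g y) < \<eta>"
          using \<eta>(1) by (simp add: closure_approachable)
      qed
      then obtain h where h: "\<And>y. y \<in> Y \<Longrightarrow> h y \<in> F i \<and> dist (h y) (g y) < \<eta>"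
        by metis
      have sep: "2 * \<eta> < dist (h y) (h z)" if yz: "y \<in> Y" "z \<in> Y" "y \<noteq> z" for y z
      proof -
        have "4 * \<eta> / c < dist y z"
          using Y(3) yz by (auto simp: pairwise_def)
        then have "4 * \<eta> < c * dist y z"
          using g(1) by (simp add: field_simps)
        also have "\<dots> \<le> dist (g y) (g z)"
          using g(3) yz Y(2) by blast
        also have "\<dots> \<le> dist (g y) (h y) + dist (h y) (h z) + dist (h z) (g z)"
          using dist_triangle[of "g y" "g z" "h y"] dist_triangle[of "h y" "g z" "h z"] by linarith
        finally show ?thesis
          using h[OF yz(1)] h[OF yz(2)] by (simp add: dist_commute)
      qed
      have "inj_on h Y"
      proof (rule inj_onI, rule ccontr)
        fix y z assume "y \<in> Y" "z \<in> Y" "h y = h z" "y \<noteq> z"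
        then show False
          using sep[of y z] \<eta>(1) by simp
      qed
      then have "card Y = card (h ` Y)"
        by (simp add: card_image)
      moreover have "card (h ` Y) \<le> (2 * \<eta>) powr - s"
      proof (rule separated_card_le_of_packing_content[OF \<delta>0(2) _ _ _ \<eta>])
        show "pairwise (\<lambda>x y. 2 * \<eta> < dist x y) (h ` Y)"
          unfolding pairwise_def using sep by blast
      qed (use Y(1) h in auto)
      ultimately have "covering_number (2 * (4 * \<eta> / c)) K \<le> (2 * \<eta>) powr - s"
        using Y(4) by linarith
      moreover have "2 * (4 * \<eta> / c) = 8 * \<delta>0 / c * \<delta>"
        by (simp add: \<eta>_def)
      moreover have "(2 * \<eta>) powr - s = (2 * \<delta>0) powr - s * \<delta> powr - s"
        using \<delta>0(1) \<delta> by (simp add: \<eta>_def powr_mult)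
      ultimately show ?thesis
        by metis
    qed
    then show "upper_box_dim K \<le> y"
      unfolding s(1) using \<delta>0(1) g(1)
      by (intro upper_box_dim_leI[OF assms(2) bK, of "8 * \<delta>0 / c" "(2 * \<delta>0) powr - s"]) auto
  qed
qed

section \<open>Triangular words and the column projection\<close>

lemma column_union:
  "(\<Union>m\<in>{1..k}. column n m) = {1..(\<Sum>l = 1..k. n l)}"
proof (induction k)
  case (Suc k)
  have "column n (Suc k) = {(\<Sum>l = 1..k. n l)<..(\<Sum>l = 1..k. n l) + n (Suc k)}"
    by (simp add: column_def atLeastLessThanSuc_atLeastAtMost)
  moreover have "(\<Union>m\<in>{1..Suc k}. column n m) = (\<Union>m\<in>{1..k}. column n m) \<union> column n (Suc k)"
    by (auto simp: atLeastAtMostSuc_conv)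
  ultimately show ?case
    using Suc by (auto simp del: UN_simps)
qed simp

lemma mem_unit_square: "x \<in> cbox 0 (1 :: real^2) \<longleftrightarrow> 0 \<le> x $ 1 \<and> x $ 1 \<le> 1 \<and> 0 \<le> x $ 2 \<and> x $ 2 \<le> 1"
  by (auto simp: mem_box_cart forall_2)

lemma norm_le_abs_components: "norm (x :: real^2) \<le> \<bar>x $ 1\<bar> + \<bar>x $ 2\<bar>"
  using norm_le_l1_cart[of x] by (simp add: sum_2)

lemma tgl_map_components [simp]:
  "tgl_map a b d t i x $ 1 = b i * x $ 1 + t i $ 1"
  "tgl_map a b d t i x $ 2 = d i * x $ 1 + a i * x $ 2 + t i $ 2"
  by (simp_all add: tgl_map_def matrix_vector_mult_def sum_2)

text \<open>The off-diagonal entry of the product of the matrices along a word.\<close>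

primrec shear :: "('i \<Rightarrow> real) \<Rightarrow> ('i \<Rightarrow> real) \<Rightarrow> ('i \<Rightarrow> real) \<Rightarrow> 'i list \<Rightarrow> real" where
  "shear a b d [] = 0"
| "shear a b d (i # w) = d i * prod_list (map b w) + a i * shear a b d w"

lemma tgl_word_diff:
  "foldr (tgl_map a b d t) w x $ 1 - foldr (tgl_map a b d t) w y $ 1
    = prod_list (map b w) * (x $ 1 - y $ 1)"
  "foldr (tgl_map a b d t) w x $ 2 - foldr (tgl_map a b d t) w y $ 2
    = shear a b d w * (x $ 1 - y $ 1) + prod_list (map a w) * (x $ 2 - y $ 2)"
proof (induction w)
  case (Cons i w)
  {
    case 1
    have "foldr (tgl_map a b d t) (i # w) x $ 1 - foldr (tgl_map a b d t) (i # w) y $ 1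
        = b i * (foldr (tgl_map a b d t) w x $ 1 - foldr (tgl_map a b d t) w y $ 1)"
      by (simp add: algebra_simps)
    then show ?case
      unfolding Cons.IH by simp
  next
    case 2
    have "foldr (tgl_map a b d t) (i # w) x $ 2 - foldr (tgl_map a b d t) (i # w) y $ 2
        = d i * (foldr (tgl_map a b d t) w x $ 1 - foldr (tgl_map a b d t) w y $ 1)
        + a i * (foldr (tgl_map a b d t) w x $ 2 - foldr (tgl_map a b d t) w y $ 2)"
      by (simp add: algebra_simps)
    then show ?case
      unfolding Cons.IH by (simp add: algebra_simps)
  }
qed auto

lemma prod_list_powr_mult:
  fixes a b :: "'i \<Rightarrow> real"
  assumes "\<And>i. i \<in> I \<Longrightarrow> 0 < a i \<and> 0 < b i" "w \<in> lists I"
  shows "prod_list (map (\<lambda>i. b i powr p * a i powr q) w)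
    = prod_list (map b w) powr p * prod_list (map a w) powr q"
  using assms(2)
proof induction
  case (Cons i w)
  then have "0 < prod_list (map a w)" "0 < prod_list (map b w)"
    using assms(1) by (auto intro!: prod_list_pos[of I])
  with Cons show ?case
    using assms(1)[of i] by (simp add: powr_mult)
qed auto

locale shifted_TGL_carpet = shifted_TGL +
  fixes \<Lambda> :: "(real^2) set" and \<Lambda>H :: "real set"
  assumes carpet: "is_attractor {1..N} (tgl_map a b d t) \<Lambda>"
    and base: "is_attractor {1..M} (column_map r u) \<Lambda>H"
begin

abbreviation f :: "nat \<Rightarrow> real^2 \<Rightarrow> real^2" where "f \<equiv> tgl_map a b d t"
abbreviation I :: "nat set" where "I \<equiv> {1..N}"
abbreviation height :: "nat list \<Rightarrow> real" where "height w \<equiv> prod_list (map a w)"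
abbreviation width :: "nat list \<Rightarrow> real" where "width w \<equiv> prod_list (map b w)"

text \<open>A bound for the slopes \<open>\<bar>d\<^sub>w\<bar> / b\<^sub>w\<close> of the images of horizontal lines, which is uniform in the
  word: if \<open>\<bar>d\<^sub>w\<bar> \<le> \<kappa> * b\<^sub>w\<close>, then
  \<open>\<bar>d\<^sub>i * b\<^sub>w + a\<^sub>i * d\<^sub>w\<bar> \<le> \<kappa> * b\<^sub>i * b\<^sub>w\<close> follows from \<open>\<bar>d\<^sub>i\<bar> \<le> \<kappa> * (b\<^sub>i - a\<^sub>i)\<close>.\<close>

definition \<kappa> :: real where "\<kappa> = Max (insert 0 ((\<lambda>i. \<bar>d i\<bar> / (b i - a i)) ` I))"

lemma \<kappa>_nonneg: "0 \<le> \<kappa>"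
  by (simp add: \<kappa>_def)

lemma pos: "i \<in> I \<Longrightarrow> 0 < a i \<and> 0 < b i"
  using contractions[of i] by linarith

lemma height_pos: "w \<in> lists I \<Longrightarrow> 0 < height w"
  using prod_list_pos[of I a w] pos by blast

lemma width_pos: "w \<in> lists I \<Longrightarrow> 0 < width w"
  using prod_list_pos[of I b w] pos by blast

lemma height_le_width: "w \<in> lists I \<Longrightarrow> height w \<le> width w"
proof (induction w)
  case (Cons i w)
  then show ?case
    using contractions[of i] height_pos[of w] by (auto intro!: mult_mono)
qed auto

lemma width_le_1: "w \<in> lists I \<Longrightarrow> width w \<le> 1"
proof (induction w)
  case (Cons i w)
  then show ?case
    using contractions[of i] width_pos[of w] by (auto intro!: mult_le_one)
qed auto

lemma shear_le: "w \<in> lists I \<Longrightarrow> \<bar>shear a b d w\<bar> \<le> \<kappa> * width w"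
proof (induction w)
  case (Cons i w)
  then have i: "i \<in> I" and w: "w \<in> lists I"
    by auto
  have "\<bar>d i\<bar> / (b i - a i) \<le> \<kappa>"
    unfolding \<kappa>_def using i by (intro Max_ge) auto
  then have d: "\<bar>d i\<bar> \<le> \<kappa> * (b i - a i)"
    using contractions[OF i] by (simp add: field_simps)
  have "\<bar>shear a b d (i # w)\<bar> \<le> \<bar>d i\<bar> * width w + a i * \<bar>shear a b d w\<bar>"
    using width_pos[OF w] pos[OF i] abs_triangle_ineq[of "d i * width w" "a i * shear a b d w"]
    by (simp add: abs_mult)
  also have "\<dots> \<le> \<kappa> * (b i - a i) * width w + a i * (\<kappa> * width w)"
    using d Cons.IH[OF w] width_pos[OF w] pos[OF i] by (intro add_mono mult_right_mono mult_left_mono) auto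
  also have "\<dots> = \<kappa> * width (i # w)"
    by (simp add: algebra_simps)
  finally show ?case .
qed (simp add: \<kappa>_nonneg)

lemma dist_word_le:
  assumes "w \<in> lists I"
  shows "dist (foldr f w x) (foldr f w y)
    \<le> (1 + \<kappa>) * (width w * \<bar>x $ 1 - y $ 1\<bar>) + height w * \<bar>x $ 2 - y $ 2\<bar>"
proof -
  have "dist (foldr f w x) (foldr f w y)
      \<le> \<bar>width w * (x $ 1 - y $ 1)\<bar> + \<bar>shear a b d w * (x $ 1 - y $ 1) + height w * (x $ 2 - y $ 2)\<bar>"
    unfolding dist_norm using norm_le_abs_components[of "foldr f w x - foldr f w y"]
    by (simp add: tgl_word_diff)
  also have "\<dots> \<le> width w * \<bar>x $ 1 - y $ 1\<bar> + (\<bar>shear a b d w\<bar> * \<bar>x $ 1 - y $ 1\<bar> + height w * \<bar>x $ 2 - y $ 2\<bar>)"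
    using abs_triangle_ineq[of "shear a b d w * (x $ 1 - y $ 1)" "height w * (x $ 2 - y $ 2)"]
      width_pos[OF assms] height_pos[OF assms] by (simp add: abs_mult)
  also have "\<dots> \<le> width w * \<bar>x $ 1 - y $ 1\<bar> + (\<kappa> * width w * \<bar>x $ 1 - y $ 1\<bar> + height w * \<bar>x $ 2 - y $ 2\<bar>)"
    using shear_le[OF assms] by (intro add_mono mult_right_mono) auto
  finally show ?thesis
    by (simp add: algebra_simps)
qed

lemma dist_word_le_width:
  assumes "w \<in> lists I"
  shows "dist (foldr f w x) (foldr f w y) \<le> (2 + \<kappa>) * width w * dist x y"
proof -
  have c: "\<bar>x $ i - y $ i\<bar> \<le> dist x y" for i
    using component_le_norm_cart[of "x - y" i] by (simp add: dist_norm)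
  have "dist (foldr f w x) (foldr f w y)
      \<le> (1 + \<kappa>) * (width w * \<bar>x $ 1 - y $ 1\<bar>) + height w * \<bar>x $ 2 - y $ 2\<bar>"
    by (rule dist_word_le[OF assms])
  also have "\<dots> \<le> (1 + \<kappa>) * (width w * dist x y) + width w * dist x y"
    using c \<kappa>_nonneg width_pos[OF assms] height_le_width[OF assms]
    by (intro add_mono mult_left_mono mult_mono) auto
  finally show ?thesis
    by (simp add: algebra_simps)
qed

lemma word_bilipschitz:
  assumes w: "w \<in> lists I"
  obtains c where "0 < c" "\<And>x y. c * dist x y \<le> dist (foldr f w x) (foldr f w y)"
proof -
  define L where "L = 1 / width w + (1 + \<kappa>) / height w"
  have h: "0 < height w" "0 < width w"
    using height_pos[OF w] width_pos[OF w] by auto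
  have L: "0 < L"
    using h \<kappa>_nonneg by (auto simp: L_def intro!: add_pos_pos)
  have "1 / L * dist x y \<le> dist (foldr f w x) (foldr f w y)" for x y
  proof -
    let ?D = "dist (foldr f w x) (foldr f w y)"
    have c: "\<bar>(foldr f w x - foldr f w y) $ i\<bar> \<le> ?D" for i
      using component_le_norm_cart[of "foldr f w x - foldr f w y" i] by (simp add: dist_norm)
    have 1: "width w * \<bar>x $ 1 - y $ 1\<bar> \<le> ?D"
      using c[of 1] h by (simp add: tgl_word_diff abs_mult)
    have "height w * \<bar>x $ 2 - y $ 2\<bar>
        = \<bar>(foldr f w x - foldr f w y) $ 2 - shear a b d w * (x $ 1 - y $ 1)\<bar>"
      using h by (simp add: tgl_word_diff abs_mult)
    also have "\<dots> \<le> ?D + \<bar>shear a b d w\<bar> * \<bar>x $ 1 - y $ 1\<bar>"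
      using c[of 2] abs_triangle_ineq4[of "(foldr f w x - foldr f w y) $ 2" "shear a b d w * (x $ 1 - y $ 1)"]
      by (simp add: abs_mult)
    also have "\<dots> \<le> ?D + \<kappa> * width w * \<bar>x $ 1 - y $ 1\<bar>"
      using shear_le[OF w] by (intro add_mono mult_right_mono) auto
    also have "\<dots> \<le> ?D + \<kappa> * ?D"
      using 1 \<kappa>_nonneg by (simp add: mult.assoc mult_left_mono)
    finally have "height w * \<bar>x $ 2 - y $ 2\<bar> \<le> (1 + \<kappa>) * ?D"
      by (simp add: algebra_simps)
    with 1 have "\<bar>x $ 1 - y $ 1\<bar> \<le> ?D / width w" "\<bar>x $ 2 - y $ 2\<bar> \<le> (1 + \<kappa>) * ?D / height w"
      using h by (simp_all add: field_simps)
    moreover have "dist x y \<le> \<bar>x $ 1 - y $ 1\<bar> + \<bar>x $ 2 - y $ 2\<bar>"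
      unfolding dist_norm using norm_le_abs_components[of "x - y"] by simp
    ultimately have "dist x y \<le> L * ?D"
      by (simp add: L_def algebra_simps)
    then show ?thesis
      using L by (simp add: field_simps)
  qed
  then show ?thesis
    using that[of "1 / L"] L by auto
qed

lemma \<Lambda>_compact: "compact \<Lambda>" and \<Lambda>_nonempty: "\<Lambda> \<noteq> {}" and \<Lambda>_eq: "\<Lambda> = (\<Union>i\<in>I. f i ` \<Lambda>)"
  using carpet by (auto simp: is_attractor_def)

lemma \<Lambda>_bounded: "bounded \<Lambda>"
  using \<Lambda>_compact by (rule compact_imp_bounded)

lemma word_image_subset:
  assumes "w \<in> lists I"
  shows "foldr f w ` \<Lambda> \<subseteq> \<Lambda>"
proof (rule foldr_maps_into[OF _ assms])
  show "f i ` \<Lambda> \<subseteq> \<Lambda>" if "i \<in> I" for i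
    using that by (subst (2) \<Lambda>_eq) blast
qed

lemma \<Lambda>_in_square: "\<Lambda> \<subseteq> cbox 0 1"
proof (rule attractor_subset_invariant[of I b \<Lambda> f _ "2 + \<kappa>"])
  show "\<Lambda> \<subseteq> (\<Union>i\<in>I. f i ` \<Lambda>)"
    using \<Lambda>_eq by blast
  show "cbox 0 (1 :: real^2) \<noteq> {}"
    using mem_unit_square[of 0] by auto
qed (use contractions pos maps_square \<Lambda>_bounded \<kappa>_nonneg dist_word_le_width in auto)

text \<open>The horizontal action of the maps: the column map, repeated once for each map of the column.\<close>

definition g :: "nat \<Rightarrow> real \<Rightarrow> real" where "g i x = b i * x + t i $ 1"

lemma columns_exhaust:
  assumes "i \<in> I"
  obtains m where "m \<in> {1..M}" "i \<in> column n m"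
  using assms column_union[of n M] columns(3) by blast

lemma column_subset: "m \<in> {1..M} \<Longrightarrow> column n m \<subseteq> I"
  using column_union[of n M] columns(3) by blast

lemma column_nonempty:
  assumes "m \<in> {1..M}"
  obtains i where "i \<in> column n m"
proof -
  have "{1..m} = insert m {1..<m}"
    using assms by auto
  then have "(\<Sum>l = 1..m. n l) = n m + (\<Sum>l = 1..<m. n l)"
    by simp
  then have "(\<Sum>l = 1..m. n l) \<in> column n m"
    using columns(2)[OF assms] by (simp add: column_def)
  then show ?thesis
    using that by blast
qed

lemma index_nonempty: "I \<noteq> {}"
proof -
  have "1 \<in> {1..M}"
    using columns(1) by simp
  then show ?thesis
    using column_nonempty column_subset by blast
qed

lemma g_eq_column_map:
  assumes "m \<in> {1..M}" "i \<in> column n m"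
  shows "g i = column_map r u m"
  using column_data[OF assms] by (auto simp: g_def column_map_def)

lemma base_eq: "\<Lambda>H = (\<Union>i\<in>I. g i ` \<Lambda>H)"
proof -
  have "\<Lambda>H = (\<Union>m\<in>{1..M}. column_map r u m ` \<Lambda>H)"
    using base by (simp add: is_attractor_def)
  also have "\<dots> = (\<Union>i\<in>I. g i ` \<Lambda>H)"
  proof (intro equalityI UN_least)
    fix m assume m: "m \<in> {1..M}"
    obtain i where "i \<in> column n m"
      using column_nonempty[OF m] .
    then show "column_map r u m ` \<Lambda>H \<subseteq> (\<Union>i\<in>I. g i ` \<Lambda>H)"
      using g_eq_column_map[OF m] column_subset[OF m] by auto
  next
    fix i assume "i \<in> I"
    then obtain m where "m \<in> {1..M}" "i \<in> column n m"
      by (rule columns_exhaust)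
    then show "g i ` \<Lambda>H \<subseteq> (\<Union>m\<in>{1..M}. column_map r u m ` \<Lambda>H)"
      using g_eq_column_map by auto
  qed
  finally show ?thesis .
qed

sublocale base: self_similar_set I g b \<Lambda>H
proof
  show "dist (g i x) (g i y) = b i * dist x y" if "i \<in> I" for i x y
    using pos[OF that] by (simp add: g_def dist_real_def abs_mult flip: right_diff_distrib)
  show "0 < b i \<and> b i < 1" if "i \<in> I" for i
    using pos[OF that] contractions[OF that] by simp
qed (use base base_eq in \<open>auto simp: is_attractor_def\<close>)

text \<open>The projection of the carpet is compact and invariant under the horizontal maps, so it is their
  attractor.\<close>

lemma projection: "(\<lambda>x. x $ 1) ` \<Lambda> = \<Lambda>H"
proof -
  let ?P = "(\<lambda>x. x $ 1) ` \<Lambda>"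
  have P_eq: "?P = (\<Union>i\<in>I. g i ` ?P)"
  proof -
    have "?P = (\<lambda>x. x $ 1) ` (\<Union>i\<in>I. f i ` \<Lambda>)"
      using \<Lambda>_eq by simp
    also have "\<dots> = (\<Union>i\<in>I. g i ` ?P)"
      by (simp add: image_UN image_image g_def)
    finally show ?thesis .
  qed
  have P_compact: "compact ?P"
    using \<Lambda>_compact by (intro compact_continuous_image continuous_intros)
  have lip: "dist (foldr g w x) (foldr g w y) \<le> 1 * width w * dist x y" if "w \<in> lists I" for w x y
    using base.dist_foldr[OF that] by simp
  have ratios: "0 < b i \<and> b i < 1" if "i \<in> I" for i
    using base.ratios[OF that] .
  have P_inv: "g i ` ?P \<subseteq> ?P" if "i \<in> I" for i
    using that by (subst (2) P_eq) blast
  have H_inv: "g i ` \<Lambda>H \<subseteq> \<Lambda>H" if "i \<in> I" for i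
    using that by (subst (2) base_eq) blast
  show ?thesis
  proof
    show "?P \<subseteq> \<Lambda>H"
      by (rule attractor_subset_invariant[of I b ?P g \<Lambda>H 1])
        (use ratios H_inv lip P_eq P_compact base.compact base.nonempty
          in \<open>auto intro: compact_imp_bounded compact_imp_closed\<close>)
    show "\<Lambda>H \<subseteq> ?P"
      by (rule attractor_subset_invariant[of I b \<Lambda>H g ?P 1])
        (use ratios P_inv lip base_eq P_compact base.compact \<Lambda>_nonempty
          in \<open>auto intro: compact_imp_bounded compact_imp_closed\<close>)
  qed
qed

lemma base_in_unit_interval: "\<Lambda>H \<subseteq> {0..1}"
  using \<Lambda>_in_square mem_unit_square by (force simp flip: projection)

text \<open>Every ball centred at a point of \<open>\<Lambda>\<close> contains a piece \<open>f\<^sub>w(\<Lambda>)\<close>, a bi-Lipschitz copy of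
  \<open>\<Lambda>\<close> because the matrix of \<open>w\<close> is invertible.\<close>

lemma packing_dim_carpet: "packing_dim \<Lambda> = upper_box_dim \<Lambda>"
proof (rule packing_dim_eq_upper_box_dim[OF \<Lambda>_compact \<Lambda>_nonempty])
  fix x and \<epsilon> :: real assume x: "x \<in> \<Lambda>" and \<epsilon>: "0 < \<epsilon>"
  define D where "D = diameter \<Lambda> + 1"
  have D: "0 < D" "\<And>x y. x \<in> \<Lambda> \<Longrightarrow> y \<in> \<Lambda> \<Longrightarrow> dist x y < D"
    using diameter_ge_0[OF \<Lambda>_bounded] diameter_bounded_bound[OF \<Lambda>_bounded] unfolding D_def
    by (linarith, meson less_add_one order.strict_trans1)
  obtain w where w: "w \<in> lists I" "x \<in> foldr f w ` \<Lambda>" "width w \<le> \<epsilon> / ((2 + \<kappa>) * D)"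
    by (rule small_piece[of I b \<Lambda> f x "\<epsilon> / ((2 + \<kappa>) * D)"])
      (use base.ratios \<Lambda>_eq x \<epsilon> D(1) \<kappa>_nonneg in auto)
  obtain c where c: "0 < c" "\<And>x y. c * dist x y \<le> dist (foldr f w x) (foldr f w y)"
    using word_bilipschitz[OF w(1)] by blast
  obtain x' where x': "x' \<in> \<Lambda>" "x = foldr f w x'"
    using w(2) by blast
  have "dist x (foldr f w y) < \<epsilon>" if "y \<in> \<Lambda>" for y
  proof -
    have "dist x (foldr f w y) \<le> (2 + \<kappa>) * width w * dist x' y"
      unfolding x'(2) by (rule dist_word_le_width[OF w(1)])
    also have "\<dots> < (2 + \<kappa>) * width w * D"
      using D(2)[OF x'(1) that] \<kappa>_nonneg width_pos[OF w(1)] by (intro mult_strict_left_mono) auto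
    also have "\<dots> = width w * ((2 + \<kappa>) * D)"
      by (simp only: mult_ac)
    also have "\<dots> \<le> \<epsilon>"
    proof -
      have "0 < (2 + \<kappa>) * D"
        using D(1) \<kappa>_nonneg by simp
      then show ?thesis
        using w(3) pos_le_divide_eq by blast
    qed
    finally show ?thesis .
  qed
  then show "\<exists>g c. 0 < c \<and> g ` \<Lambda> \<subseteq> \<Lambda> \<inter> ball x \<epsilon> \<and> (\<forall>y\<in>\<Lambda>. \<forall>z\<in>\<Lambda>. c * dist y z \<le> dist (g y) (g z))"
    using c word_image_subset[OF w(1)] by (intro exI[of _ "foldr f w"] exI[of _ c]) auto
qed

section \<open>Covering numbers of the carpet\<close>

lemma stopping_set_height:
  assumes "0 < \<delta>" "\<delta> \<le> 1" "\<And>i. i \<in> I \<Longrightarrow> l \<le> a i" "0 < l"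
  obtains W where "stopping_set I W" "\<And>w. w \<in> W \<Longrightarrow> w \<in> lists I \<and> l * \<delta> \<le> height w \<and> height w \<le> \<delta>"
proof -
  obtain l' R where lR: "0 < l'" "l' \<le> 1" "R < 1"
    "\<And>i. i \<in> I \<Longrightarrow> l' \<le> a i" "\<And>i. i \<in> I \<Longrightarrow> a i \<le> R"
  proof (rule finite_ratio_bounds[of I a])
    show "0 < a i \<and> a i < 1" if "i \<in> I" for i
      using contractions[OF that] by linarith
  qed auto
  obtain W where W: "stopping_set I W"
    "\<And>w. w \<in> W \<Longrightarrow> l * \<delta> \<le> height w \<and> height w \<le> \<delta>"
    by (rule stopping_set_exists[of I l a R \<delta>]) (use assms lR in auto)
  then show ?thesis
    using that[of W] stopping_set_words[OF W(1)] by blast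
qed

text \<open>A piece \<open>f\<^sub>w(\<Lambda>)\<close> is cut into vertical strips, one for each set of a cover of the projection at
  scale \<open>a\<^sub>w / b\<^sub>w\<close>. The width of the image of a strip is then comparable to its height \<open>a\<^sub>w\<close>.\<close>

lemma covering_number_carpet_le:
  assumes W: "stopping_set I W" "\<And>w. w \<in> W \<Longrightarrow> w \<in> lists I \<and> height w \<le> \<delta>"
  shows "covering_number ((2 + \<kappa>) * \<delta>) \<Lambda> \<le> (\<Sum>w\<in>W. covering_number (height w / width w) \<Lambda>H)"
proof -
  have hw: "0 < height w" "0 < width w" if "w \<in> W" for w
    using W(2)[OF that] height_pos width_pos by auto
  have fin: "finite W"
    by (rule stopping_set_finite[OF W(1)]) simp
  have "\<exists>C. finite C \<and> \<Lambda>H \<subseteq> \<Union>C \<and> (\<forall>J\<in>C. bounded J \<and> diameter J \<le> height w / width w) \<and>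
      card C = covering_number (height w / width w) \<Lambda>H" if w: "w \<in> W" for w
  proof -
    obtain C where "finite C" "\<Lambda>H \<subseteq> \<Union>C" "\<And>J. J \<in> C \<Longrightarrow> bounded J \<and> diameter J \<le> height w / width w"
      "card C = covering_number (height w / width w) \<Lambda>H"
      by (rule covering_number_attained[OF base.bounded, of "height w / width w"]) (use hw[OF w] in auto)
    then show ?thesis
      by blast
  qed
  then obtain C where C: "\<And>w. w \<in> W \<Longrightarrow> finite (C w)" "\<And>w. w \<in> W \<Longrightarrow> \<Lambda>H \<subseteq> \<Union>(C w)"
    "\<And>w J. w \<in> W \<Longrightarrow> J \<in> C w \<Longrightarrow> bounded J \<and> diameter J \<le> height w / width w"
    "\<And>w. w \<in> W \<Longrightarrow> card (C w) = covering_number (height w / width w) \<Lambda>H"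
    by metis
  define strip where "strip w J = foldr f w ` {x \<in> \<Lambda>. x $ 1 \<in> J}" for w J
  let ?D = "\<Union>w\<in>W. strip w ` C w"
  have "covering_number ((2 + \<kappa>) * \<delta>) \<Lambda> \<le> card ?D"
  proof (rule covering_number_le)
    show "finite ?D"
      using fin C(1) by blast
    show "\<Lambda> \<subseteq> \<Union>?D"
    proof
      fix x assume "x \<in> \<Lambda>"
      moreover have "\<Lambda> \<subseteq> (\<Union>w\<in>W. foldr f w ` \<Lambda>)"
        using stopping_set_covers[OF W(1), of \<Lambda> f] \<Lambda>_eq by simp
      ultimately obtain w y where w: "w \<in> W" "y \<in> \<Lambda>" "x = foldr f w y"
        by blast
      then have "y $ 1 \<in> \<Lambda>H"
        using projection by blast
      then obtain J where "J \<in> C w" "y $ 1 \<in> J"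
        using C(2)[OF w(1)] by blast
      then show "x \<in> \<Union>?D"
        using w by (auto simp: strip_def)
    qed
    fix A assume "A \<in> ?D"
    then obtain w J where w: "w \<in> W" "J \<in> C w" "A = strip w J"
      by blast
    have "A \<subseteq> \<Lambda>"
      using word_image_subset W(2)[OF w(1)] w(3) by (auto simp: strip_def)
    then have "bounded A"
      using \<Lambda>_bounded bounded_subset by blast
    moreover have "diameter A \<le> (2 + \<kappa>) * \<delta>"
    proof (rule diameter_le_dist)
      show "0 \<le> (2 + \<kappa>) * \<delta>"
        using hw[OF w(1)] W(2)[OF w(1)] \<kappa>_nonneg by auto
      fix x y assume "x \<in> A" "y \<in> A"
      then obtain x' y' where xy: "x' \<in> \<Lambda>" "y' \<in> \<Lambda>" "x' $ 1 \<in> J" "y' $ 1 \<in> J"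
        "x = foldr f w x'" "y = foldr f w y'"
        using w(3) by (auto simp: strip_def)
      have "\<bar>x' $ 1 - y' $ 1\<bar> \<le> height w / width w"
        using diameter_bounded_bound[of J "x' $ 1" "y' $ 1"] C(3)[OF w(1,2)] xy(3,4)
        by (simp add: dist_real_def)
      then have 1: "width w * \<bar>x' $ 1 - y' $ 1\<bar> \<le> height w"
        using hw[OF w(1)] by (simp add: field_simps)
      have "x' \<in> cbox 0 1" "y' \<in> cbox 0 1"
        using xy(1,2) \<Lambda>_in_square by auto
      then have 2: "\<bar>x' $ 2 - y' $ 2\<bar> \<le> 1"
        by (auto simp: mem_unit_square)
      have "dist x y \<le> (1 + \<kappa>) * (width w * \<bar>x' $ 1 - y' $ 1\<bar>) + height w * \<bar>x' $ 2 - y' $ 2\<bar>"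
        unfolding xy(5,6) by (rule dist_word_le) (use W(2)[OF w(1)] in auto)
      also have "\<dots> \<le> (1 + \<kappa>) * height w + height w * 1"
        using 1 2 \<kappa>_nonneg hw[OF w(1)] by (intro add_mono mult_left_mono) auto
      also have "\<dots> = (2 + \<kappa>) * height w"
        by (simp add: algebra_simps)
      also have "\<dots> \<le> (2 + \<kappa>) * \<delta>"
        using W(2)[OF w(1)] \<kappa>_nonneg by (intro mult_left_mono) auto
      finally show "dist x y \<le> (2 + \<kappa>) * \<delta>" .
    qed
    ultimately show "bounded A \<and> diameter A \<le> (2 + \<kappa>) * \<delta>"
      by blast
  qed
  also have "\<dots> \<le> (\<Sum>w\<in>W. card (strip w ` C w))"
    using fin by (rule card_UN_le)
  also have "\<dots> \<le> (\<Sum>w\<in>W. covering_number (height w / width w) \<Lambda>H)"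
  proof (rule sum_mono)
    fix w assume "w \<in> W"
    then show "card (strip w ` C w) \<le> covering_number (height w / width w) \<Lambda>H"
      using card_image_le[OF C(1), of w "strip w"] C(4)[of w] by simp
  qed
  finally show ?thesis .
qed

lemma word_image_box:
  assumes "w \<in> lists I" "\<And>i. p $ i \<le> q $ i"
  shows "foldr f w ` box p q \<in> lmeasurable"
    and "measure lebesgue (foldr f w ` box p q)
      = width w * height w * ((q $ 1 - p $ 1) * (q $ 2 - p $ 2))"
proof -
  let ?A = "vector [vector [width w, 0], vector [shear a b d w, height w]] :: real^2^2"
  have "foldr f w x = foldr f w 0 + ?A *v x" for x
    using tgl_word_diff[of a b d t w x 0]
    by (simp add: vec_eq_iff forall_2 matrix_vector_mult_def sum_2 algebra_simps)
  then have eq: "foldr f w ` box p q = (+) (foldr f w 0) ` ((*v) ?A ` box p q)"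
    unfolding image_image by (intro image_cong refl)
  have "cbox p q \<noteq> {}"
    using assms(2) by (auto simp: interval_ne_empty_cart)
  then have "measure lborel (box p q) = (q $ 1 - p $ 1) * (q $ 2 - p $ 2)"
    using content_cbox_cart[of p q] measure_lborel_box_eq[of p q] measure_lborel_cbox_eq[of p q]
    by (simp add: UNIV_2)
  then have area: "measure lebesgue (box p q) = (q $ 1 - p $ 1) * (q $ 2 - p $ 2)"
    by simp
  have "\<bar>det ?A\<bar> = width w * height w"
    using width_pos[OF assms(1)] height_pos[OF assms(1)] by (simp add: det_2 abs_mult)
  then show "measure lebesgue (foldr f w ` box p q)
      = width w * height w * ((q $ 1 - p $ 1) * (q $ 2 - p $ 2))"
    unfolding eq measure_translation
    by (subst measure_linear_image) (simp_all add: area)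
  show "foldr f w ` box p q \<in> lmeasurable"
    unfolding eq by (intro measurable_translation measurable_linear_image) simp_all
qed

text \<open>Under the open set condition a set of diameter \<open>\<delta>\<close> meets boundedly many pieces of height
  about \<open>\<delta>\<close>: next to the point where it meets the piece \<open>f\<^sub>w(\<Lambda>)\<close>, the parallelogram
  \<open>f\<^sub>w(U)\<close> contains the image of a vertical strip of width \<open>a\<^sub>w / b\<^sub>w\<close>. This image has area
  \<open>a\<^sub>w\<^sup>2\<close> and diameter of order \<open>a\<^sub>w\<close>, and the images for different words are disjoint.\<close>

lemma card_pieces_meeting_le:
  assumes rosc: "rosc I f \<Lambda>" and W: "stopping_set I W"
    "\<And>w. w \<in> W \<Longrightarrow> w \<in> lists I \<and> l * \<delta> \<le> height w \<and> height w \<le> \<delta>"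
    and "0 < l" "0 < \<delta>" and A: "bounded A" "diameter A \<le> \<delta>"
  shows "card {w \<in> W. A \<inter> foldr f w ` \<Lambda> \<noteq> {}} \<le> (2 * (3 + \<kappa>) / l)\<^sup>2"
proof -
  let ?V = "{w \<in> W. A \<inter> foldr f w ` \<Lambda> \<noteq> {}}"
  let ?U = "box 0 1 :: (real^2) set"
  have finV: "finite ?V"
    using stopping_set_finite[OF W(1)] by simp
  show ?thesis
  proof (cases "?V = {}")
    case False
    then obtain z where z: "z \<in> A"
      by blast
    define \<rho> where "\<rho> = (3 + \<kappa>) * \<delta>"
    define B where "B = cbox (\<chi> i. z $ i - \<rho>) (\<chi> i. z $ i + \<rho>)"
    have \<rho>: "0 \<le> \<rho>"
      using \<kappa>_nonneg assms(5) by (simp add: \<rho>_def)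
    have "\<exists>S. S \<subseteq> B \<and> S \<subseteq> foldr f w ` ?U \<and> S \<in> lmeasurable \<and> (l * \<delta>)\<^sup>2 \<le> measure lebesgue S"
      if w: "w \<in> ?V" for w
    proof -
      have words: "w \<in> lists I" and h: "l * \<delta> \<le> height w" "height w \<le> \<delta>"
        using w W(2) by auto
      have hw: "0 < height w" "0 < width w" "height w \<le> width w"
        using height_pos width_pos height_le_width words by auto
      obtain x where x: "x \<in> \<Lambda>" "foldr f w x \<in> A"
        using w by blast
      have sq: "0 \<le> x $ 1" "x $ 1 \<le> 1" "0 \<le> x $ 2" "x $ 2 \<le> 1"
        using x(1) \<Lambda>_in_square mem_unit_square by auto
      define \<eta> where "\<eta> = height w / width w"
      have \<eta>: "0 < \<eta>" "\<eta> \<le> 1"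
        using hw by (auto simp: \<eta>_def)
      \<comment> \<open>The interval of length \<open>\<eta>\<close> that divides the unit interval at \<open>x $ 1\<close> in the same ratio.\<close>
      define c where "c = x $ 1 * (1 - \<eta>)"
      have c: "0 \<le> c" "c \<le> x $ 1" "x $ 1 \<le> c + \<eta>" "c + \<eta> \<le> 1"
      proof -
        show "0 \<le> c"
          using sq \<eta> by (simp add: c_def)
        show "c \<le> x $ 1"
          using sq \<eta> by (simp add: c_def mult_left_le)
        have "0 \<le> \<eta> * (1 - x $ 1)" "0 \<le> (1 - \<eta>) * (1 - x $ 1)"
          using sq \<eta> by simp_all
        then show "x $ 1 \<le> c + \<eta>" "c + \<eta> \<le> 1"
          by (simp_all add: c_def algebra_simps)
      qed
      define p q :: "real^2" where "p = vector [c, 0]" and "q = vector [c + \<eta>, 1]"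
      have pq: "p $ i \<le> q $ i" for i
        using \<eta> exhaust_2[of i] by (auto simp: p_def q_def)
      have mem: "y \<in> box p q \<longleftrightarrow> c < y $ 1 \<and> y $ 1 < c + \<eta> \<and> 0 < y $ 2 \<and> y $ 2 < 1" for y
        by (auto simp: mem_box_cart forall_2 p_def q_def)
      have "box p q \<subseteq> ?U"
        using c by (auto simp: mem) (auto simp: mem_box_cart forall_2)
      moreover have "foldr f w ` box p q \<subseteq> B"
      proof
        fix y' assume "y' \<in> foldr f w ` box p q"
        then obtain y where y: "y \<in> box p q" "y' = foldr f w y"
          by blast
        have "\<bar>x $ 1 - y $ 1\<bar> \<le> \<eta>" and 2: "\<bar>x $ 2 - y $ 2\<bar> \<le> 1"
          using y(1) c sq by (auto simp: mem)
        then have 1: "width w * \<bar>x $ 1 - y $ 1\<bar> \<le> height w"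
          using hw by (simp add: \<eta>_def field_simps)
        have "dist (foldr f w x) y' \<le> (1 + \<kappa>) * (width w * \<bar>x $ 1 - y $ 1\<bar>) + height w * \<bar>x $ 2 - y $ 2\<bar>"
          unfolding y(2) by (rule dist_word_le[OF words])
        also have "\<dots> \<le> (1 + \<kappa>) * height w + height w * 1"
          using 1 2 \<kappa>_nonneg hw by (intro add_mono mult_left_mono) auto
        also have "\<dots> = (2 + \<kappa>) * height w"
          by (simp add: algebra_simps)
        also have "\<dots> \<le> (2 + \<kappa>) * \<delta>"
          using h \<kappa>_nonneg by (intro mult_left_mono) auto
        finally have "dist (foldr f w x) y' \<le> (2 + \<kappa>) * \<delta>" .
        moreover have "dist z (foldr f w x) \<le> \<delta>"
          using diameter_bounded_bound[OF A(1) z x(2)] A(2) by linarith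
        ultimately have "dist z y' \<le> \<rho>"
          using dist_triangle[of z y' "foldr f w x"] by (simp add: \<rho>_def algebra_simps)
        then have "\<bar>z $ i - y' $ i\<bar> \<le> \<rho>" for i
          using component_le_norm_cart[of "z - y'" i] by (simp add: dist_norm)
        then show "y' \<in> B"
          unfolding B_def mem_box_cart by (auto simp: abs_le_iff) (smt (verit))+
      qed
      moreover have "(l * \<delta>)\<^sup>2 \<le> measure lebesgue (foldr f w ` box p q)"
      proof -
        have "(l * \<delta>)\<^sup>2 \<le> (height w)\<^sup>2"
          using h assms(4,5) by (intro power_mono) auto
        also have "\<dots> = width w * height w * (\<eta> * 1)"
          using hw by (simp add: \<eta>_def power2_eq_square)
        also have "\<dots> = measure lebesgue (foldr f w ` box p q)"
          by (subst word_image_box(2)[OF words pq]) (simp add: p_def q_def)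
        finally show ?thesis .
      qed
      ultimately show ?thesis
        using word_image_box(1)[OF words pq] by (intro exI[of _ "foldr f w ` box p q"]) auto
    qed
    then have "\<exists>S. \<forall>w\<in>?V. S w \<subseteq> B \<and> S w \<subseteq> foldr f w ` ?U \<and> S w \<in> lmeasurable \<and>
        (l * \<delta>)\<^sup>2 \<le> measure lebesgue (S w)"
      by (intro bchoice ballI)
    then obtain S where "\<forall>w\<in>?V. S w \<subseteq> B \<and> S w \<subseteq> foldr f w ` ?U \<and> S w \<in> lmeasurable \<and>
        (l * \<delta>)\<^sup>2 \<le> measure lebesgue (S w)"
      by (rule exE)
    then have S: "S w \<subseteq> B" "S w \<subseteq> foldr f w ` ?U" "S w \<in> lmeasurable"
      "(l * \<delta>)\<^sup>2 \<le> measure lebesgue (S w)" if "w \<in> ?V" for w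
      using that by simp_all
    note R = rosc[unfolded rosc_def Let_def]
    note into = R[THEN conjunct2, THEN conjunct1] and disjoint = R[THEN conjunct2, THEN conjunct2]
    have "disjoint_family_on (\<lambda>w. foldr f w ` ?U) W"
    proof (rule stopping_set_disjoint[OF W(1)])
      fix i assume i: "i \<in> I"
      show "f i ` ?U \<subseteq> ?U"
        using into i by (simp only: UN_subset_iff)
      show "inj_on (f i) ?U"
      proof (rule inj_onI)
        fix x y assume "f i x = f i y"
        then have "f i x $ 1 = f i y $ 1" "f i x $ 2 = f i y $ 2"
          by simp_all
        then show "x = y"
          using pos[OF i] by (simp add: vec_eq_iff forall_2)
      qed
    next
      fix i j assume "i \<in> I" "j \<in> I" "i \<noteq> j"
      then show "f i ` ?U \<inter> f j ` ?U = {}"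
        using disjoint by blast
    qed
    then have D: "foldr f v ` ?U \<inter> foldr f w ` ?U = {}" if "v \<in> ?V" "w \<in> ?V" "v \<noteq> w" for v w
      using that by (simp add: disjoint_family_on_def)
    have disj: "disjoint_family_on S ?V"
      unfolding disjoint_family_on_def
    proof (intro ballI impI)
      fix v w assume "v \<in> ?V" "w \<in> ?V" "v \<noteq> w"
      from S(2)[OF this(1)] S(2)[OF this(2)] D[OF this] show "S v \<inter> S w = {}"
        by fast
    qed
    have "real (card ?V) * (l * \<delta>)\<^sup>2 \<le> (\<Sum>w\<in>?V. measure lebesgue (S w))"
      using sum_bounded_below[of ?V "(l * \<delta>)\<^sup>2", OF S(4)] by simp
    also have "\<dots> = measure lebesgue (\<Union>w\<in>?V. S w)"
    proof (rule measure_finite_Union[symmetric, OF finV _ disj])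
      show "S ` ?V \<subseteq> sets lebesgue"
        by (intro image_subsetI fmeasurableD S(3))
      show "emeasure lebesgue (S w) \<noteq> \<infinity>" if "w \<in> ?V" for w
        unfolding infinity_ennreal_def by (rule fmeasurableD2[OF S(3)[OF that]])
    qed
    also have "\<dots> \<le> measure lebesgue B"
    proof (rule measure_mono_fmeasurable)
      show "(\<Union>w\<in>?V. S w) \<in> sets lebesgue"
        by (intro sets.finite_UN[OF finV] fmeasurableD S(3))
      show "(\<Union>w\<in>?V. S w) \<subseteq> B"
        by (rule UN_least[OF S(1)])
    qed (simp add: B_def)
    also have "\<dots> = (2 * \<rho>)\<^sup>2"
    proof -
      have "B \<noteq> {}"
        using \<rho> by (simp add: B_def interval_ne_empty_cart)
      then have "measure lborel B = (2 * \<rho>)\<^sup>2"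
        unfolding B_def by (subst content_cbox_cart) (auto simp: UNIV_2 power2_eq_square)
      then show ?thesis
        by (simp add: B_def)
    qed
    also have "2 * \<rho> = 2 * (3 + \<kappa>) / l * (l * \<delta>)"
      using assms(4) by (simp add: \<rho>_def)
    finally have "real (card ?V) * (l * \<delta>)\<^sup>2 \<le> (2 * (3 + \<kappa>) / l)\<^sup>2 * (l * \<delta>)\<^sup>2"
      by (simp only: power_mult_distrib)
    moreover have "0 < (l * \<delta>)\<^sup>2"
      using assms(4,5) by simp
    ultimately show ?thesis
      by (rule mult_right_le_imp_le)
  next
    case True
    show ?thesis
      unfolding True by simp
  qed
qed

text \<open>The members of a cover of \<open>\<Lambda>\<close> that meet \<open>f\<^sub>w(\<Lambda>)\<close>, pulled back by \<open>f\<^sub>w\<close> and projected,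
  cover the base at scale \<open>a\<^sub>w / b\<^sub>w\<close>. Each member is used for boundedly many words.\<close>

lemma sum_covering_number_base_le:
  assumes rosc: "rosc I f \<Lambda>" and W: "stopping_set I W"
    "\<And>w. w \<in> W \<Longrightarrow> w \<in> lists I \<and> l * \<delta> \<le> height w \<and> height w \<le> \<delta>"
    and l: "0 < l" "l \<le> 1" and \<delta>: "0 < \<delta>"
  shows "(\<Sum>w\<in>W. real (covering_number (height w / width w) \<Lambda>H))
    \<le> (2 * (3 + \<kappa>) / l)\<^sup>2 * covering_number (l * \<delta>) \<Lambda>"
proof -
  let ?Q = "(2 * (3 + \<kappa>) / l)\<^sup>2"
  have fin: "finite W"
    by (rule stopping_set_finite[OF W(1)]) simp
  obtain C where C: "finite C" "\<Lambda> \<subseteq> \<Union>C" "\<And>A. A \<in> C \<Longrightarrow> bounded A \<and> diameter A \<le> l * \<delta>"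
    "card C = covering_number (l * \<delta>) \<Lambda>"
    by (rule covering_number_attained[OF \<Lambda>_bounded, of "l * \<delta>"]) (use l \<delta> in auto)
  have one: "covering_number (height w / width w) \<Lambda>H \<le> card {A \<in> C. A \<inter> foldr f w ` \<Lambda> \<noteq> {}}"
    if w: "w \<in> W" for w
  proof -
    let ?C = "{A \<in> C. A \<inter> foldr f w ` \<Lambda> \<noteq> {}}"
    define trace where "trace A = (\<lambda>x. x $ 1) ` {x \<in> \<Lambda>. foldr f w x \<in> A}" for A
    have words: "w \<in> lists I" and h: "l * \<delta> \<le> height w"
      using W(2)[OF w] by auto
    have "covering_number (height w / width w) \<Lambda>H \<le> card (trace ` ?C)"
    proof (rule covering_number_le)
      show "\<Lambda>H \<subseteq> \<Union>(trace ` ?C)"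
      proof
        fix y assume "y \<in> \<Lambda>H"
        then obtain x where x: "x \<in> \<Lambda>" "y = x $ 1"
          using projection by blast
        then have "foldr f w x \<in> \<Lambda>"
          using word_image_subset[OF words] by blast
        then obtain A where "A \<in> C" "foldr f w x \<in> A"
          using C(2) by blast
        then show "y \<in> \<Union>(trace ` ?C)"
          using x by (auto simp: trace_def)
      qed
      fix J assume "J \<in> trace ` ?C"
      then obtain A where A: "A \<in> C" "J = trace A"
        by blast
      have "J \<subseteq> \<Lambda>H"
        using A(2) projection by (auto simp: trace_def)
      then have "bounded J"
        using base.bounded bounded_subset by blast
      moreover have "diameter J \<le> height w / width w"
      proof (rule diameter_le_dist)
        show "0 \<le> height w / width w"
          using height_pos[OF words] width_pos[OF words] by simp
        fix x' y' assume "x' \<in> J" "y' \<in> J"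
        then obtain x y where xy: "foldr f w x \<in> A" "foldr f w y \<in> A" "x' = x $ 1" "y' = y $ 1"
          using A(2) by (auto simp: trace_def)
        have "width w * \<bar>x $ 1 - y $ 1\<bar> = \<bar>(foldr f w x - foldr f w y) $ 1\<bar>"
          using width_pos[OF words] by (simp add: tgl_word_diff abs_mult)
        also have "\<dots> \<le> dist (foldr f w x) (foldr f w y)"
          unfolding dist_norm by (rule component_le_norm_cart)
        also have "\<dots> \<le> l * \<delta>"
          using diameter_bounded_bound[of A, OF _ xy(1,2)] C(3)[OF A(1)] by linarith
        finally show "dist x' y' \<le> height w / width w"
          using h width_pos[OF words] xy(3,4) by (simp add: dist_real_def field_simps)
      qed
      ultimately show "bounded J \<and> diameter J \<le> height w / width w"
        by blast
    qed (use C(1) in simp)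
    also have "\<dots> \<le> card ?C"
      using C(1) by (intro card_image_le) simp
    finally show ?thesis .
  qed
  have "(\<Sum>w\<in>W. real (covering_number (height w / width w) \<Lambda>H))
      \<le> (\<Sum>w\<in>W. real (card {A \<in> C. A \<inter> foldr f w ` \<Lambda> \<noteq> {}}))"
    using one by (intro sum_mono) simp
  also have "\<dots> = (\<Sum>w\<in>W. \<Sum>A\<in>{A \<in> C. A \<inter> foldr f w ` \<Lambda> \<noteq> {}}. 1)"
    by simp
  also have "\<dots> = (\<Sum>A\<in>C. \<Sum>w\<in>{w \<in> W. A \<inter> foldr f w ` \<Lambda> \<noteq> {}}. 1)"
    by (rule sum.swap_restrict[OF fin C(1)])
  also have "\<dots> = (\<Sum>A\<in>C. real (card {w \<in> W. A \<inter> foldr f w ` \<Lambda> \<noteq> {}}))"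
    by simp
  also have "\<dots> \<le> (\<Sum>A\<in>C. ?Q)"
  proof (rule sum_mono)
    fix A assume "A \<in> C"
    moreover have "l * \<delta> \<le> 1 * \<delta>"
      using l \<delta> by (intro mult_right_mono) auto
    ultimately have "bounded A" "diameter A \<le> \<delta>"
      using C(3)[of A] by auto
    from card_pieces_meeting_le[OF rosc W(1) _ l(1) \<delta> this]
    show "real (card {w \<in> W. A \<inter> foldr f w ` \<Lambda> \<noteq> {}}) \<le> ?Q"
      using W(2) by blast
  qed
  finally show ?thesis
    using C(4) by (simp add: mult.commute)
qed

section \<open>The dimension formula\<close>

text \<open>The base lies in the unit interval, and it is also the attractor of all the maps \<open>g i\<close>, with
  each column counted as often as it has maps. These two facts give the two upper bounds.\<close>

lemma base_box_dim:
  shows "has_box_dim \<Lambda>H (box_dim \<Lambda>H)" "0 \<le> box_dim \<Lambda>H" "box_dim \<Lambda>H \<le> 1"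
    and "\<And>x. (\<Sum>i\<in>I. b i powr x) = 1 \<Longrightarrow> box_dim \<Lambda>H \<le> x"
proof -
  obtain s where s: "has_box_dim \<Lambda>H s" "0 \<le> s"
    by (rule base.box_dim_exists)
  note D = has_box_dimD[OF s(1)]
  show "has_box_dim \<Lambda>H (box_dim \<Lambda>H)" "0 \<le> box_dim \<Lambda>H"
    using s D(3) by auto
  have "ereal s \<le> 1"
    using order_trans[OF upper_box_dim_mono[OF base.nonempty base_in_unit_interval bounded_closed_interval]
        upper_box_dim_unit_interval_le_1] D(1)
    by simp
  then show "box_dim \<Lambda>H \<le> 1"
    using D(3) by simp
  fix x assume x: "(\<Sum>i\<in>I. b i powr x) = 1"
  have "0 \<le> x"
  proof (rule ccontr)
    assume "\<not> 0 \<le> x"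
    have "1 < b i powr x" if "i \<in> I" for i
      using \<open>\<not> 0 \<le> x\<close> pos[OF that] contractions[OF that] powr_less_mono'[of "b i" x 0] by simp
    moreover obtain i where i: "i \<in> I"
      using index_nonempty by blast
    moreover have "b i powr x \<le> (\<Sum>i\<in>I. b i powr x)"
      by (rule member_le_sum) (use i in auto)
    ultimately show False
      using x by fastforce
  qed
  then show "box_dim \<Lambda>H \<le> x"
    using base.upper_box_dim_le_similarity_dim[OF x] D(1,3) by simp
qed

lemma weighted_equation_root:
  "\<exists>!s. (\<Sum>i\<in>I. b i powr p * a i powr (s - p)) = 1"
proof -
  have "(\<Sum>i\<in>I. b i powr p * a i powr (s - p)) = (\<Sum>i\<in>I. (b i powr p * a i powr - p) * a i powr s)" for s
    by (intro sum.cong) (auto simp: powr_diff powr_minus field_simps)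
  moreover have "\<exists>!s. (\<Sum>i\<in>I. (b i powr p * a i powr - p) * a i powr s) = 1"
    using index_nonempty pos contractions by (intro weighted_powr_sum_root) force+
  ultimately show ?thesis
    by simp
qed

text \<open>Since \<open>a i < b i\<close>, the left-hand side of the equation increases with \<open>p\<close>, and it decreases with
  the unknown. Hence the solution increases with \<open>p\<close>.\<close>

lemma weighted_equation_root_mono:
  assumes "(\<Sum>i\<in>I. b i powr p * a i powr (s - p)) = 1" "(\<Sum>i\<in>I. b i powr q * a i powr (s' - q)) = 1"
    and "p \<le> q"
  shows "s \<le> s'"
proof (rule ccontr)
  assume "\<not> s \<le> s'"
  have "(\<Sum>i\<in>I. b i powr p * a i powr (s - p)) < (\<Sum>i\<in>I. b i powr q * a i powr (s' - q))"
  proof (rule sum_strict_mono)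
    fix i assume "i \<in> I"
    then have i: "0 < a i" "a i < b i" "a i < 1"
      using contractions[of i] by auto
    have "b i powr p * a i powr (s - p) = (b i / a i) powr p * a i powr s"
      using i by (simp add: powr_divide powr_diff)
    also have "\<dots> < (b i / a i) powr p * a i powr s'"
      using i \<open>\<not> s \<le> s'\<close> by (intro mult_strict_left_mono powr_less_mono') auto
    also have "\<dots> \<le> (b i / a i) powr q * a i powr s'"
      using i assms(3) by (intro mult_right_mono powr_mono) auto
    also have "\<dots> = b i powr q * a i powr (s' - q)"
      using i by (simp add: powr_divide powr_diff)
    finally show "b i powr p * a i powr (s - p) < b i powr q * a i powr (s' - q)" .
  qed (use index_nonempty in auto)
  then show False
    using assms by simp
qed

lemma root_le_affinity_dim:
  assumes "(\<Sum>i\<in>I. b i powr box_dim \<Lambda>H * a i powr (s - box_dim \<Lambda>H)) = 1"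
  shows "s \<le> affinity_dim N a b"
proof -
  have "\<exists>!x. (\<Sum>i\<in>I. 1 * b i powr x) = 1"
    using index_nonempty base.ratios by (intro weighted_powr_sum_root) auto
  then have "(\<Sum>i\<in>I. b i powr x_similarity_dim N b) = 1"
    unfolding x_similarity_dim_def mult_1 by (rule theI')
  then have le: "box_dim \<Lambda>H \<le> min (x_similarity_dim N b) 1"
    using base_box_dim(3,4) by simp
  let ?p = "min (x_similarity_dim N b) 1"
  have "(\<Sum>i\<in>I. b i powr ?p * a i powr (affinity_dim N a b - ?p)) = 1"
    unfolding affinity_dim_def Let_def by (rule theI'[OF weighted_equation_root])
  then show ?thesis
    by (rule weighted_equation_root_mono[OF assms _ le])
qed

lemma root_nonneg:
  assumes "(\<Sum>i\<in>I. b i powr box_dim \<Lambda>H * a i powr (s - box_dim \<Lambda>H)) = 1"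
  shows "0 \<le> s"
proof -
  obtain s0 where s0: "(\<Sum>i\<in>I. b i powr 0 * a i powr (s0 - 0)) = 1"
    using weighted_equation_root[of 0] by blast
  have "0 \<le> s0"
  proof (rule ccontr)
    assume "\<not> 0 \<le> s0"
    have "1 < b i powr 0 * a i powr (s0 - 0)" if "i \<in> I" for i
      using \<open>\<not> 0 \<le> s0\<close> pos[OF that] contractions[OF that] powr_less_mono'[of "a i" s0 0] by simp
    moreover obtain i where i: "i \<in> I"
      using index_nonempty by blast
    moreover have "b i powr 0 * a i powr (s0 - 0) \<le> (\<Sum>i\<in>I. b i powr 0 * a i powr (s0 - 0))"
      by (rule member_le_sum) (use i in auto)
    ultimately show False
      using s0 by fastforce
  qed
  then show ?thesis
    using weighted_equation_root_mono[OF s0 assms base_box_dim(2)] by simp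
qed

lemma ratio_powr_minus:
  fixes x y e :: real
  assumes "0 < x" "0 < y"
  shows "(x / y) powr - e = y powr e * x powr - e"
  using assms by (simp add: powr_divide powr_minus field_simps)

text \<open>Along a stopping set the weights of the equation for \<open>s\<close> add up to 1. A covering
  number of the base at scale \<open>a\<^sub>w / b\<^sub>w\<close> is about \<open>(b\<^sub>w / a\<^sub>w) powr box_dim \<Lambda>H\<close>, which is the
  weight of \<open>w\<close> times \<open>a\<^sub>w powr - s\<close>, so the sum of these numbers is about \<open>\<delta> powr - s\<close>.\<close>

lemma stopping_set_weights:
  assumes "(\<Sum>i\<in>I. b i powr p * a i powr (s - p)) = 1" "stopping_set I W"
  shows "(\<Sum>w\<in>W. width w powr p * height w powr (s - p)) = 1"
proof -
  have "(\<Sum>w\<in>W. width w powr p * height w powr (s - p))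
      = (\<Sum>w\<in>W. prod_list (map (\<lambda>i. b i powr p * a i powr (s - p)) w))"
  proof (rule sum.cong)
    fix w assume "w \<in> W"
    then have w: "w \<in> lists I"
      using stopping_set_words[OF assms(2)] by blast
    show "width w powr p * height w powr (s - p) = prod_list (map (\<lambda>i. b i powr p * a i powr (s - p)) w)"
      by (rule prod_list_powr_mult[symmetric, of I]) (use pos w in auto)
  qed simp
  also have "\<dots> = 1"
    by (rule stopping_set_sum_weights[OF assms(2) _ assms(1)]) simp
  finally show ?thesis .
qed

lemma height_bound:
  obtains l where "0 < l" "l \<le> 1" "\<And>i. i \<in> I \<Longrightarrow> l \<le> a i"
proof -
  have "0 < a i \<and> a i < 1" if "i \<in> I" for i
    using contractions[OF that] by linarith
  then show ?thesis
    using that finite_ratio_bounds[of I a thesis] by blast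
qed

lemma upper_box_dim_carpet_le:
  assumes s: "(\<Sum>i\<in>I. b i powr box_dim \<Lambda>H * a i powr (s - box_dim \<Lambda>H)) = 1"
  shows "upper_box_dim \<Lambda> \<le> ereal s"
proof (rule ereal_le_epsilon2)
  fix \<epsilon> :: real assume \<epsilon>: "0 < \<epsilon>"
  let ?h = "box_dim \<Lambda>H"
  have "upper_box_dim \<Lambda>H < ereal (?h + \<epsilon>)"
    using has_box_dimD(1)[OF base_box_dim(1)] \<epsilon> by simp
  then obtain C where C: "0 < C" "\<And>\<delta>. 0 < \<delta> \<Longrightarrow> \<delta> \<le> 1 \<Longrightarrow> covering_number \<delta> \<Lambda>H \<le> C * \<delta> powr - (?h + \<epsilon>)"
    using covering_number_upper_bound[OF base.nonempty base.bounded] by blast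
  obtain l where l: "0 < l" "l \<le> 1" "\<And>i. i \<in> I \<Longrightarrow> l \<le> a i"
    using height_bound by blast
  have s0: "0 \<le> s"
    by (rule root_nonneg[OF s])
  have "covering_number ((2 + \<kappa>) * \<delta>) \<Lambda> \<le> C * l powr - (s + \<epsilon>) * \<delta> powr - (s + \<epsilon>)"
    if \<delta>: "0 < \<delta>" "\<delta> \<le> 1" for \<delta>
  proof -
    obtain W where W: "stopping_set I W"
      "\<And>w. w \<in> W \<Longrightarrow> w \<in> lists I \<and> l * \<delta> \<le> height w \<and> height w \<le> \<delta>"
      by (rule stopping_set_height[of \<delta> l]) (use l \<delta> in auto)
    have "real (covering_number ((2 + \<kappa>) * \<delta>) \<Lambda>)
        \<le> (\<Sum>w\<in>W. real (covering_number (height w / width w) \<Lambda>H))"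
      using covering_number_carpet_le[OF W(1), of \<delta>] W(2) by (simp flip: of_nat_sum)
    also have "\<dots> \<le> (\<Sum>w\<in>W. C * (l * \<delta>) powr - (s + \<epsilon>) * (width w powr ?h * height w powr (s - ?h)))"
    proof (rule sum_mono)
      fix w assume "w \<in> W"
      then have h: "0 < height w" "0 < width w" "height w \<le> width w" "width w \<le> 1" "l * \<delta> \<le> height w"
        using W(2)[of w] height_pos width_pos height_le_width width_le_1 by auto
      have "covering_number (height w / width w) \<Lambda>H \<le> C * (height w / width w) powr - (?h + \<epsilon>)"
        using h by (intro C(2)) auto
      also have "(height w / width w) powr - (?h + \<epsilon>)
          = width w powr \<epsilon> * (height w powr - (s + \<epsilon>) * (width w powr ?h * height w powr (s - ?h)))"
      proof -
        have "(height w / width w) powr - (?h + \<epsilon>) = width w powr (?h + \<epsilon>) * height w powr - (?h + \<epsilon>)"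
          by (rule ratio_powr_minus[OF h(1,2)])
        moreover have "height w powr - (?h + \<epsilon>) = height w powr - (s + \<epsilon>) * height w powr (s - ?h)"
          by (simp add: algebra_simps flip: powr_add)
        ultimately show ?thesis
          by (simp only: powr_add mult_ac)
      qed
      also have "\<dots> \<le> 1 * ((l * \<delta>) powr - (s + \<epsilon>) * (width w powr ?h * height w powr (s - ?h)))"
      proof (rule mult_mono)
        show "width w powr \<epsilon> \<le> 1"
          using h \<epsilon> by (intro powr_le1) auto
        have "height w powr - (s + \<epsilon>) \<le> (l * \<delta>) powr - (s + \<epsilon>)"
          using h \<epsilon> s0 l(1) \<delta>(1) by (intro powr_mono2') auto
        then show "height w powr - (s + \<epsilon>) * (width w powr ?h * height w powr (s - ?h))
            \<le> (l * \<delta>) powr - (s + \<epsilon>) * (width w powr ?h * height w powr (s - ?h))"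
          by (rule mult_right_mono) simp
      qed auto
      finally show "real (covering_number (height w / width w) \<Lambda>H)
          \<le> C * (l * \<delta>) powr - (s + \<epsilon>) * (width w powr ?h * height w powr (s - ?h))"
        using C(1) by simp
    qed
    also have "\<dots> = C * (l * \<delta>) powr - (s + \<epsilon>)"
      using stopping_set_weights[OF s W(1)] by (simp flip: sum_distrib_left)
    also have "\<dots> = C * l powr - (s + \<epsilon>) * \<delta> powr - (s + \<epsilon>)"
      using l \<delta> by (simp add: powr_mult)
    finally show ?thesis .
  qed
  then have "upper_box_dim \<Lambda> \<le> ereal (s + \<epsilon>)"
    by (intro upper_box_dim_leI[OF \<Lambda>_nonempty \<Lambda>_bounded, of "2 + \<kappa>" "C * l powr - (s + \<epsilon>)"])
      (use C(1) l \<kappa>_nonneg in auto)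
  then show "upper_box_dim \<Lambda> \<le> ereal s + ereal \<epsilon>"
    by simp
qed

lemma lower_box_dim_carpet_ge:
  assumes s: "(\<Sum>i\<in>I. b i powr box_dim \<Lambda>H * a i powr (s - box_dim \<Lambda>H)) = 1"
    and rosc: "rosc I f \<Lambda>"
  shows "ereal s \<le> lower_box_dim \<Lambda>"
proof (rule dense_le)
  fix y assume "y < ereal s"
  show "y \<le> lower_box_dim \<Lambda>"
  proof (cases "y \<le> 0")
    case True
    then show ?thesis
      using lower_box_dim_nonneg[OF \<Lambda>_nonempty \<Lambda>_bounded] by (rule order_trans)
  next
    case False
    then obtain t where t: "y = ereal t" "0 < t" "t < s"
      using \<open>y < ereal s\<close> by (cases y) auto
    define \<epsilon> where "\<epsilon> = s - t"
    have \<epsilon>: "0 < \<epsilon>"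
      using t by (simp add: \<epsilon>_def)
    let ?h = "box_dim \<Lambda>H"
    have "ereal (?h - \<epsilon>) < lower_box_dim \<Lambda>H"
      using has_box_dimD(2)[OF base_box_dim(1)] \<epsilon> by simp
    then obtain C where C: "0 < C" "\<And>\<delta>. 0 < \<delta> \<Longrightarrow> \<delta> \<le> 1 \<Longrightarrow> C * \<delta> powr - (?h - \<epsilon>) \<le> covering_number \<delta> \<Lambda>H"
      using covering_number_lower_bound[OF base.nonempty base.bounded] by blast
    obtain l where l: "0 < l" "l \<le> 1" "\<And>i. i \<in> I \<Longrightarrow> l \<le> a i"
      using height_bound by blast
    define Q where "Q = (2 * (3 + \<kappa>) / l)\<^sup>2"
    have Q: "0 < Q"
      using \<kappa>_nonneg l(1) by (simp add: Q_def add_pos_nonneg)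
    have "C / Q * \<delta> powr - t \<le> covering_number (l * \<delta>) \<Lambda>" if \<delta>: "0 < \<delta>" "\<delta> \<le> 1" for \<delta>
    proof -
      obtain W where W: "stopping_set I W"
        "\<And>w. w \<in> W \<Longrightarrow> w \<in> lists I \<and> l * \<delta> \<le> height w \<and> height w \<le> \<delta>"
        by (rule stopping_set_height[of \<delta> l]) (use l \<delta> in auto)
      have "C * \<delta> powr - t = (\<Sum>w\<in>W. C * \<delta> powr - t * (width w powr ?h * height w powr (s - ?h)))"
        using stopping_set_weights[OF s W(1)] by (simp flip: sum_distrib_left)
      also have "\<dots> \<le> (\<Sum>w\<in>W. real (covering_number (height w / width w) \<Lambda>H))"
      proof (rule sum_mono)
        fix w assume "w \<in> W"
        then have h: "0 < height w" "0 < width w" "height w \<le> width w" "width w \<le> 1" "height w \<le> \<delta>"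
          using W(2)[of w] height_pos width_pos height_le_width width_le_1 by auto
        have "1 \<le> width w powr - \<epsilon>"
          using h \<epsilon> powr_mono'[of "- \<epsilon>" 0 "width w"] by simp
        moreover have "\<delta> powr - t \<le> height w powr - t"
          using h t by (intro powr_mono2') auto
        ultimately have "1 * (\<delta> powr - t * (width w powr ?h * height w powr (s - ?h)))
            \<le> width w powr - \<epsilon> * (height w powr - t * (width w powr ?h * height w powr (s - ?h)))"
          by (intro mult_mono[OF _ mult_right_mono]) auto
        also have "\<dots> = (height w / width w) powr - (?h - \<epsilon>)"
        proof -
          have "(height w / width w) powr - (?h - \<epsilon>) = width w powr (?h + - \<epsilon>) * height w powr - (?h - \<epsilon>)"
            using ratio_powr_minus[OF h(1,2), of "?h - \<epsilon>"] by simp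
          moreover have "height w powr - (?h - \<epsilon>) = height w powr - t * height w powr (s - ?h)"
            by (simp add: \<epsilon>_def algebra_simps flip: powr_add)
          ultimately show ?thesis
            by (simp only: powr_add mult_ac)
        qed
        finally have "C * \<delta> powr - t * (width w powr ?h * height w powr (s - ?h))
            \<le> C * (height w / width w) powr - (?h - \<epsilon>)"
          using C(1) by simp
        also have "\<dots> \<le> covering_number (height w / width w) \<Lambda>H"
          using h by (intro C(2)) auto
        finally show "C * \<delta> powr - t * (width w powr ?h * height w powr (s - ?h))
            \<le> real (covering_number (height w / width w) \<Lambda>H)" .
      qed
      also have "\<dots> \<le> Q * covering_number (l * \<delta>) \<Lambda>"
        unfolding Q_def by (rule sum_covering_number_base_le[OF rosc W(1) _ l(1,2) \<delta>(1)]) (rule W(2))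
      finally show ?thesis
        using Q by (simp add: field_simps)
    qed
    then show ?thesis
      unfolding t(1)
      by (intro lower_box_dim_geI[OF \<Lambda>_nonempty \<Lambda>_bounded, of l "C / Q"]) (use C(1) l Q in auto)
  qed
qed

end

theorem theorem3p4:
  fixes N M :: nat and n :: "nat \<Rightarrow> nat"
    and a b d :: "nat \<Rightarrow> real" and t :: "nat \<Rightarrow> real^2"
    and r u :: "nat \<Rightarrow> real"
    and \<Lambda> :: "(real^2) set" and \<Lambda>H :: "real set" and sH :: real
  assumes "shifted_TGL N M n a b d t r u"
    and "is_attractor {1..N} (tgl_map a b d t) \<Lambda>"
    and "is_attractor {1..M} (column_map r u) \<Lambda>H"
    and "sH = box_dim \<Lambda>H"
  shows "\<exists>s. (\<forall>s'. (\<Sum>i = 1..N. b i powr sH * a i powr (s' - sH)) = 1 \<longleftrightarrow> s' = s) \<and>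
           packing_dim \<Lambda> = upper_box_dim \<Lambda> \<and>
           upper_box_dim \<Lambda> \<le> ereal s \<and>
           s \<le> affinity_dim N a b \<and>
           (rosc {1..N} (tgl_map a b d t) \<Lambda> \<longrightarrow>
              packing_dim \<Lambda> = ereal s \<and> has_box_dim \<Lambda> s)"
proof -
  interpret shifted_TGL_carpet N M n a b d t r u \<Lambda> \<Lambda>H
    using assms(1-3) by (simp add: shifted_TGL_carpet_def shifted_TGL_carpet_axioms_def)
  obtain s where s: "(\<Sum>i = 1..N. b i powr sH * a i powr (s - sH)) = 1"
    "\<And>s'. (\<Sum>i = 1..N. b i powr sH * a i powr (s' - sH)) = 1 \<Longrightarrow> s' = s"
    using weighted_equation_root[of sH] by blast
  note s' = s(1)[unfolded assms(4)]
  have "packing_dim \<Lambda> = ereal s \<and> has_box_dim \<Lambda> s" if "rosc {1..N} (tgl_map a b d t) \<Lambda>"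
  proof -
    have "has_box_dim \<Lambda> s"
      by (rule has_box_dimI[OF upper_box_dim_carpet_le[OF s'] lower_box_dim_carpet_ge[OF s' that]])
    then show ?thesis
      using has_box_dimD(1) packing_dim_carpet by simp
  qed
  then show ?thesis
    using s packing_dim_carpet upper_box_dim_carpet_le[OF s'] root_le_affinity_dim[OF s']
    by (intro exI[of _ s]) blast
qed

end
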